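(* For $1\le n\le 6$, let $t_0,\dots,t_7\in\mathbb C^*$ and $t,p,q$ be parameters such that $|p|,|q|,|t|<1$ (with $q,t\neq0$). Then, whenever all terms are defined (in particular the denominators are nonzero), $$\sum_{0\le i\le n+1}\frac{t_i\, I\!I^{(n)}_{t;p,q}(t_0,\dots,qt_i,\dots,t_7)}{\prod_{0\le j\le n+1;\,j\ne i}\theta_p(t_it_j^{\pm1})}=0,$$ where in the $i$-th term the argument $t_i$ is replaced by $qt_i$ and all other arguments are unchanged.
   Context: $\theta_p(x)=\prod_{k\ge0}(1-p^{k+1}/x)(1-p^kx)$, $\Gamma_{p,q}(x)=\prod_{j,k\ge0}(1-p^{j+1}q^{k+1}/x)(1-p^jq^kx)^{-1}$, $(p;p)=\prod_{i\ge1}(1-p^i)$. Several arguments, or $\pm$ exponents, denote a product over all arguments/choices of signs: $\theta_p(xy^{\pm1})=\theta_p(xy)\theta_p(x/y)$, and $\Gamma_{p,q}(tz_i^{\pm1}z_j^{\pm1})$ is a product of four factors. For an integer $n\ge1$, $$I\!I^{(n)}_{t;p,q}(t_0,\dots,t_7)=\frac{(p;p)^n(q;q)^n}{2^nn!}\int_{C^n}\prod_{1\le i<j\le n}\frac{\Gamma_{p,q}(tz_i^{\pm1}z_j^{\pm1})}{\Gamma_{p,q}(z_i^{\pm1}z_j^{\pm1})}\prod_{1\le i\le n}\frac{\prod_{0\le r\le7}\Gamma_{p,q}(t_rz_i^{\pm1})}{\Gamma_{p,q}(z_i^{\pm2})}\frac{dz_i}{2\pi\sqrt{-1}\,z_i},$$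 where $C$ is the unit circle when all $|t_r|<1$; for other $t_r\in\mathbb C^*$ the integral is defined by deforming the contour, i.e. by meromorphic continuation in $(t_0,\dots,t_7)\in(\mathbb C^* )^8$. *)

theory Defs
  imports "HOL-Complex_Analysis.Complex_Analysis"
begin

definition theta :: "complex \<Rightarrow> complex \<Rightarrow> complex" where
  "theta p x = (\<Prod>k. (1 - p ^ (k + 1) / x) * (1 - p ^ k * x))"

text \<open>At a pole one of the factors below is \<open>inverse 0 = 0\<close>, so the product takes the
  junk value 0 there, which makes the reciprocal \<open>1 / ell_gamma p q x\<close> take its correct value 0.\<close>

definition ell_gamma :: "complex \<Rightarrow> complex \<Rightarrow> complex \<Rightarrow> complex" where
  "ell_gamma p q x =
     (\<Prod>j. \<Prod>k. (1 - p ^ (j + 1) * q ^ (k + 1) / x) * inverse (1 - p ^ j * q ^ k * x))"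

definition euler_prod :: "complex \<Rightarrow> complex" where
  "euler_prod p = (\<Prod>i. 1 - p ^ (i + 1))"

text \<open>The parameters \<open>t\<^sub>0, \<dots>, t\<^sub>7\<close> form a vector \<open>ts :: complex^8\<close>; the index \<open>r\<close> of \<open>t\<^sub>r\<close>
  is an element of the type 8, whose elements are the residues 0, ..., 7.\<close>

definition II_integrand ::
  "nat \<Rightarrow> complex \<Rightarrow> complex \<Rightarrow> complex \<Rightarrow> complex^8 \<Rightarrow> (nat \<Rightarrow> complex) \<Rightarrow> complex" where
  "II_integrand n t p q ts z =
     (\<Prod>j\<in>{1..n}. \<Prod>i\<in>{1..<j}.
        (ell_gamma p q (t * z i * z j) * ell_gamma p q (t * z i / z j) *
         ell_gamma p q (t * z j / z i) * ell_gamma p q (t / (z i * z j))) /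
        (ell_gamma p q (z i * z j) * ell_gamma p q (z i / z j) *
         ell_gamma p q (z j / z i) * ell_gamma p q (1 / (z i * z j)))) *
     (\<Prod>i\<in>{1..n}.
        (\<Prod>r\<in>UNIV. ell_gamma p q (ts $ r * z i) * ell_gamma p q (ts $ r / z i)) /
        (ell_gamma p q (z i ^ 2) * ell_gamma p q (1 / z i ^ 2)) *
        (1 / (2 * of_real pi * \<i> * z i)))"

text \<open>The integral of \<open>f(z\<^sub>1, \<dots>, z\<^sub>n) dz\<^sub>1 \<dots> dz\<^sub>n\<close> over the \<open>n\<close>-th power of the positively
  oriented unit circle, by pulling back along \<open>circlepath 0 1\<close> in every variable.\<close>

definition torus_integral :: "nat \<Rightarrow> ((nat \<Rightarrow> complex) \<Rightarrow> complex) \<Rightarrow> complex" where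
  "torus_integral n f =
     (LINT x | (\<Pi>\<^sub>M i\<in>{1..n}. restrict_space lborel {0..1}).
        f (\<lambda>i. circlepath 0 1 (x i)) *
        (\<Prod>i\<in>{1..n}. vector_derivative (circlepath 0 1) (at (x i))))"

definition II_unit_circle :: "nat \<Rightarrow> complex \<Rightarrow> complex \<Rightarrow> complex \<Rightarrow> complex^8 \<Rightarrow> complex" where
  "II_unit_circle n t p q ts =
     euler_prod p ^ n * euler_prod q ^ n / (2 ^ n * fact n) *
     torus_integral n (II_integrand n t p q ts)"

text \<open>Holomorphic and meromorphic functions of several complex variables. Holomorphy is
  Frechet differentiability with complex-linear derivative (meant for open sets), and a
  meromorphic function is locally a quotient of holomorphic functions, the values on the zero set
  of the denominator being irrelevant.\<close>

definition mv_holomorphic_on :: "(complex^'n \<Rightarrow> complex) \<Rightarrow> (complex^'n) set \<Rightarrow> bool" where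
  "mv_holomorphic_on f U \<longleftrightarrow>
     (\<forall>x\<in>U. \<exists>f'. (f has_derivative f') (at x) \<and> (\<forall>c v. f' (c *s v) = c * f' v))"

definition mv_meromorphic_on :: "(complex^'n \<Rightarrow> complex) \<Rightarrow> (complex^'n) set \<Rightarrow> bool" where
  "mv_meromorphic_on f D \<longleftrightarrow>
     (\<forall>x\<in>D. \<exists>U g h. open U \<and> connected U \<and> x \<in> U \<and> U \<subseteq> D \<and>
        mv_holomorphic_on g U \<and> mv_holomorphic_on h U \<and> (\<exists>y\<in>U. h y \<noteq> 0) \<and>
        (\<forall>y\<in>U. h y \<noteq> 0 \<longrightarrow> f y = g y / h y))"

definition cstar8 :: "(complex^8) set" where
  "cstar8 = {ts. \<forall>r. ts $ r \<noteq> 0}"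

definition punctured_polydisc8 :: "(complex^8) set" where
  "punctured_polydisc8 = {ts. \<forall>r. ts $ r \<noteq> 0 \<and> norm (ts $ r) < 1}"

text \<open>\<open>II_value n t p q ts v\<close>: the integral is defined at \<open>ts\<close>, with value \<open>v\<close>. Outside the
  polydisc this means that the meromorphic continuation is regular at \<open>ts\<close>; since the
  continuation is determined only up to its values on a nowhere dense set, \<open>F\<close> ranges over all of
  its representatives and the value is read off from one that is holomorphic near \<open>ts\<close>.\<close>

definition II_value ::
  "nat \<Rightarrow> complex \<Rightarrow> complex \<Rightarrow> complex \<Rightarrow> complex^8 \<Rightarrow> complex \<Rightarrow> bool" where
  "II_value n t p q ts v \<longleftrightarrow>
     (if ts \<in> punctured_polydisc8 then v = II_unit_circle n t p q ts
      else ts \<in> cstar8 \<and>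
        (\<exists>F. mv_meromorphic_on F cstar8 \<and>
             (\<forall>s\<in>punctured_polydisc8. F s = II_unit_circle n t p q s) \<and>
             (\<exists>U. open U \<and> ts \<in> U \<and> mv_holomorphic_on F U) \<and> v = F ts))"

definition II_defined :: "nat \<Rightarrow> complex \<Rightarrow> complex \<Rightarrow> complex \<Rightarrow> complex^8 \<Rightarrow> bool" where
  "II_defined n t p q ts \<longleftrightarrow> (\<exists>v. II_value n t p q ts v)"

definition II :: "nat \<Rightarrow> complex \<Rightarrow> complex \<Rightarrow> complex \<Rightarrow> complex^8 \<Rightarrow> complex" where
  "II n t p q ts = (THE v. II_value n t p q ts v)"

definition q_shift :: "complex \<Rightarrow> nat \<Rightarrow> complex^8 \<Rightarrow> complex^8" where
  "q_shift q i ts = (\<chi> r. if r = of_nat i then q * ts $ r else ts $ r)"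

end

theory Submission
  imports Defs "HOL-Probability.Infinite_Product_Measure"
begin

text \<open>On the unit torus \<open>\<Gamma>(qx) = \<theta>(x) \<Gamma>(x)\<close> shows that replacing \<open>t\<^sub>i\<close> by \<open>q t\<^sub>i\<close> multiplies the
  integrand by \<open>\<Prod>\<^sub>k \<theta>(t\<^sub>i z\<^sub>k) \<theta>(t\<^sub>i / z\<^sub>k)\<close>. The sum of these factors, with the coefficients of the
  theorem, vanishes for every fixed \<open>z\<close>: with \<open>[x, y] = \<theta>(xy) \<theta>(x/y) / x\<close> it is
  \<open>\<Sum>\<^sub>i \<Prod>\<^sub>k [t\<^sub>i, z\<^sub>k] / \<Prod>\<^sub>j\<^sub>\<noteq>\<^sub>i [t\<^sub>i, t\<^sub>j]\<close>, and the three-term relation of the bracket eliminates the variables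
  \<open>z\<^sub>k\<close> one by one. This proves the theorem where all the integrals are over the unit circle; after
  clearing denominators the identity extends to all parameters by the identity theorem for
  meromorphic functions of several variables.\<close>

section \<open>Infinite products, theta functions and elliptic gamma functions\<close>

text \<open>The three-term relation is a Liouville argument on the nonzero complex numbers modulo
  powers of \<open>p\<close>. It divides by theta functions, which is why the zeros of
  \<open>theta p\<close> are located and shown to be simple. For \<open>p = 0\<close>, which the
  theorem admits, there is no period, and the relation is elementary.

  The meromorphic continuation of the integral is never constructed. If some
  \<open>t\<^sub>r\<close> has modulus at least 1, shifting another parameter leaves it in place, so
  definedness at that shifted point supplies a continuation. For the integral itself continuity in
  the parameters suffices; it serves the shifted points that have moved inside the polydisc.

  A continuation is determined only up to its values on a nowhere dense set, and each shifted point
  comes with its own representative. The identity theorem is therefore stated as vanishing at points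
  of continuity.\<close>

definition qprod :: "complex \<Rightarrow> (complex \<Rightarrow> complex) \<Rightarrow> complex \<Rightarrow> complex" where
  "qprod p f x = (\<Prod>k. f (p ^ k * x))"

text \<open>Mean value estimate: \<open>deriv f\<close> is bounded on the compact disc. At arguments
  \<open>p ^ k * x\<close> the linear bound decays geometrically in \<open>k\<close>, which drives
  the convergence of the products below.\<close>

lemma entire_minus_1_bound:
  assumes "f holomorphic_on UNIV" "f 0 = (1::complex)"
  obtains C where "C \<ge> 0" "\<And>x. norm x \<le> R \<Longrightarrow> norm (f x - 1) \<le> C * norm x"
proof -
  have d: "deriv f holomorphic_on UNIV"
    using assms(1) by (simp add: holomorphic_deriv)
  have "compact (deriv f ` cball 0 R)"
    by (intro compact_continuous_image holomorphic_on_imp_continuous_on holomorphic_on_subset[OF d]) auto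
  then obtain C where C: "\<And>x. x \<in> cball 0 R \<Longrightarrow> norm (deriv f x) \<le> C"
    by (meson bounded_iff compact_imp_bounded image_eqI)
  show thesis
  proof (rule that[of "max C 0"])
    fix x :: complex assume x: "norm x \<le> R"
    have "R \<ge> 0" using x norm_ge_zero order_trans by blast
    have "norm (f x - f 0) \<le> max C 0 * norm (x - 0)"
    proof (rule field_differentiable_bound[where S = "cball 0 R" and f' = "deriv f"])
      show "(f has_field_derivative deriv f z) (at z within cball 0 R)" for z
        using assms(1) holomorphic_derivI[of f UNIV z] has_field_derivative_at_within by blast
      show "norm (deriv f z) \<le> max C 0" if "z \<in> cball 0 R" for z
        using C[OF that] by simp
    qed (use x \<open>R \<ge> 0\<close> in auto)
    then show "norm (f x - 1) \<le> max C 0 * norm x" using assms by simp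
  qed auto
qed

context
  fixes p :: complex and f :: "complex \<Rightarrow> complex"
  assumes p: "norm p < 1" and f: "f holomorphic_on UNIV" and f0: "f 0 = 1"
begin

text \<open>A majorant independent of \<open>x\<close> serves both absolute convergence at a point
  and the Weierstrass test for locally uniform convergence.\<close>

lemma qprod_summable_bound:
  "\<exists>M. summable M \<and> (\<forall>k x. norm x \<le> R \<longrightarrow> norm (f (p ^ k * x) - 1) \<le> M k)"
proof -
  obtain C where C: "C \<ge> 0" "\<And>x. norm x \<le> R \<Longrightarrow> norm (f x - 1) \<le> C * norm x"
    by (rule entire_minus_1_bound[OF f f0, of R]) blast
  show ?thesis
  proof (intro exI conjI allI impI)
    show "summable (\<lambda>k. C * (norm p ^ k * R))"
      using p by (intro summable_mult summable_mult2 summable_geometric) auto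
    fix k :: nat and x :: complex assume x: "norm x \<le> R"
    have le: "norm (p ^ k * x) \<le> norm p ^ k * R"
      using x by (simp add: norm_mult norm_power mult_left_mono)
    have "norm (p ^ k * x) \<le> norm x"
      using p by (simp add: norm_mult norm_power mult_left_le_one_le power_le_one)
    then have "norm (f (p ^ k * x) - 1) \<le> C * norm (p ^ k * x)"
      using x by (intro C) auto
    also have "\<dots> \<le> C * (norm p ^ k * R)" using le C(1) by (rule mult_left_mono)
    finally show "norm (f (p ^ k * x) - 1) \<le> C * (norm p ^ k * R)" .
  qed
qed

lemma convergent_prod_qprod: "convergent_prod (\<lambda>k. f (p ^ k * x))"
proof -
  obtain M where M: "summable M \<and> (\<forall>k y. norm y \<le> norm x \<longrightarrow> norm (f (p ^ k * y) - 1) \<le> M k)"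
    using qprod_summable_bound by (rule exE)
  then have "summable (\<lambda>k. norm (f (p ^ k * x) - 1))"
    using summable_comparison_test'[of M 0 "\<lambda>k. norm (f (p ^ k * x) - 1)"] by auto
  then show ?thesis
    by (rule abs_convergent_prod_imp_convergent_prod[OF summable_imp_abs_convergent_prod])
qed

lemma qprod_holomorphic_UNIV: "qprod p f holomorphic_on UNIV"
proof (rule holomorphic_uniform_sequence)
  show "(\<lambda>x. \<Prod>k<n. f (p ^ k * x)) holomorphic_on UNIV" for n
    by (intro holomorphic_intros holomorphic_on_compose_gen[OF _ f, unfolded o_def]) auto
  show "\<exists>d>0. cball x d \<subseteq> UNIV \<and>
      uniform_limit (cball x d) (\<lambda>n x. \<Prod>k<n. f (p ^ k * x)) (qprod p f) sequentially" for x
  proof (intro exI[of _ 1] conjI)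
    have sub: "cball x 1 \<subseteq> cball 0 (norm x + 1)"
      by (auto simp: dist_norm) (smt (verit) norm_minus_commute norm_triangle_sub)
    obtain M where M: "summable M \<and> (\<forall>k y. norm y \<le> norm x + 1 \<longrightarrow> norm (f (p ^ k * y) - 1) \<le> M k)"
      using qprod_summable_bound by (rule exE)
    have "uniformly_convergent_on (cball x 1) (\<lambda>N y. \<Sum>k<N. norm (f (p ^ k * y) - 1))"
      using sub M by (intro Weierstrass_m_test') (auto simp: subset_iff)
    moreover have "continuous_on (cball x 1) (\<lambda>y. f (p ^ k * y))" for k
      by (rule continuous_on_compose2[OF holomorphic_on_imp_continuous_on[OF f]])
        (auto intro!: continuous_intros)
    ultimately have "uniformly_convergent_on (cball x 1) (\<lambda>N y. \<Prod>k<N. f (p ^ k * y))"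
      by (intro uniformly_convergent_on_prod') auto
    then obtain l where l: "uniform_limit (cball x 1) (\<lambda>N y. \<Prod>k<N. f (p ^ k * y)) l sequentially"
      by (auto simp: uniformly_convergent_on_def)
    have "l y = qprod p f y" if "y \<in> cball x 1" for y
    proof (rule LIMSEQ_unique)
      show "(\<lambda>N. \<Prod>k<N. f (p ^ k * y)) \<longlonglongrightarrow> l y"
        using tendsto_uniform_limitI[OF l that] .
      show "(\<lambda>N. \<Prod>k<N. f (p ^ k * y)) \<longlonglongrightarrow> qprod p f y"
        unfolding qprod_def
        by (intro has_prod_imp_tendsto' convergent_prod_has_prod convergent_prod_qprod)
    qed
    then show "uniform_limit (cball x 1) (\<lambda>n x. \<Prod>k<n. f (p ^ k * x)) (qprod p f) sequentially"
      using l by (rule_tac uniform_limit_cong'[THEN iffD1, OF refl _ l]) auto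
  qed auto
qed auto

lemma qprod_eq_0_iff: "qprod p f x = 0 \<longleftrightarrow> (\<exists>k. f (p ^ k * x) = 0)"
proof -
  have "(\<lambda>k. f (p ^ k * x)) has_prod qprod p f x"
    unfolding qprod_def by (intro convergent_prod_has_prod convergent_prod_qprod)
  from has_prod_eq_0_iff[OF this] show ?thesis by auto
qed

lemma qprod_step: "qprod p f x = f x * qprod p f (p * x)"
proof -
  have "(\<lambda>k. f (p ^ k * (p * x))) has_prod qprod p f (p * x)"
    unfolding qprod_def by (intro convergent_prod_has_prod convergent_prod_qprod)
  then have "(\<lambda>k. f (p ^ Suc k * x)) has_prod qprod p f (p * x)"
    by (simp add: mult_ac)
  from has_prod_Suc_imp[OF this] have "(\<lambda>k. f (p ^ k * x)) has_prod (qprod p f (p * x) * f x)"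
    by simp
  then show ?thesis unfolding qprod_def[of p f x]
    using has_prod_unique by (metis mult.commute)
qed

lemma qprod_0: "qprod p f 0 = 1"
  by (simp add: qprod_def f0)

end

section \<open>q-Pochhammer symbols, and theta and elliptic gamma functions in terms of them\<close>

abbreviation qpoch :: "complex \<Rightarrow> complex \<Rightarrow> complex" where
  "qpoch p \<equiv> qprod p (\<lambda>x. 1 - x)"

text \<open>\<open>qpoch q\<close> is itself entire with value 1 at 0, so the double product is
  \<open>qprod\<close> applied twice and inherits its lemmas.\<close>

abbreviation qpoch2 :: "complex \<Rightarrow> complex \<Rightarrow> complex \<Rightarrow> complex" where
  "qpoch2 p q \<equiv> qprod p (qpoch q)"

lemma one_minus_entire: "(\<lambda>x. 1 - x :: complex) holomorphic_on UNIV"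
  by (intro holomorphic_intros)

lemma
  assumes "norm p < 1"
  shows qpoch_entire: "qpoch p holomorphic_on UNIV"
    and qpoch_eq_0_iff: "qpoch p x = 0 \<longleftrightarrow> (\<exists>k. p ^ k * x = 1)"
    and qpoch_step: "qpoch p x = (1 - x) * qpoch p (p * x)"
    and qpoch_0: "qpoch p 0 = 1"
  using qprod_holomorphic_UNIV[OF assms one_minus_entire] qprod_eq_0_iff[OF assms one_minus_entire, of x]
    qprod_step[OF assms one_minus_entire, of x] qprod_0[OF assms one_minus_entire]
  by (auto simp: eq_commute[of 1])

lemma
  assumes "norm p < 1" "norm q < 1"
  shows qpoch2_entire: "qpoch2 p q holomorphic_on UNIV"
    and qpoch2_eq_0_iff: "qpoch2 p q x = 0 \<longleftrightarrow> (\<exists>j k. q ^ k * (p ^ j * x) = 1)"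
    and qpoch2_shift: "qpoch2 p q x = qpoch p x * qpoch2 p q (q * x)"
proof -
  note e = qpoch_entire[OF assms(2)] qpoch_0[OF assms(2)]
  show "qpoch2 p q holomorphic_on UNIV"
    by (rule qprod_holomorphic_UNIV[OF assms(1) e])
  show "qpoch2 p q x = 0 \<longleftrightarrow> (\<exists>j k. q ^ k * (p ^ j * x) = 1)"
    by (simp add: qprod_eq_0_iff[OF assms(1) e] qpoch_eq_0_iff[OF assms(2)])
  \<comment> \<open>Each inner product gives up its factor with \<open>k = 0\<close>, namely
    \<open>1 - p ^ j * x\<close>; over all \<open>j\<close> these make up
    \<open>qpoch p x\<close>.\<close>
  have "qpoch2 p q x = (\<Prod>j. (1 - p ^ j * x) * qpoch q (p ^ j * (q * x)))"
    unfolding qprod_def[of p "qpoch q"]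
    by (rule prodinf_cong, subst qpoch_step[OF assms(2)]) (simp add: mult_ac)
  also have "\<dots> = qpoch p x * qpoch2 p q (q * x)"
    unfolding qprod_def[of p "\<lambda>x. 1 - x"] qprod_def[of p "qpoch q"]
    by (rule prodinf_mult[symmetric] convergent_prod_qprod[OF assms(1)] one_minus_entire e | simp)+
  finally show "qpoch2 p q x = qpoch p x * qpoch2 p q (q * x)" .
qed

lemma theta_eq_qpoch:
  assumes "norm p < 1"
  shows "theta p x = qpoch p (p / x) * qpoch p x"
proof -
  have "theta p x = (\<Prod>k. (1 - p ^ k * (p / x)) * (1 - p ^ k * x))"
    unfolding theta_def by (intro prodinf_cong) (simp add: mult_ac)
  also have "\<dots> = qpoch p (p / x) * qpoch p x"
    unfolding qprod_def
    by (rule prodinf_mult[symmetric] convergent_prod_qprod[OF assms] one_minus_entire | simp)+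
  finally show ?thesis .
qed

text \<open>Valid at poles too: the infinite product with a factor \<open>inverse 0 = 0\<close> and
  the quotient with zero denominator are both 0. So properties of \<open>ell_gamma\<close> reduce to
  those of an entire function.\<close>

lemma ell_gamma_eq_qpoch2:
  assumes "norm p < 1" "norm q < 1"
  shows "ell_gamma p q x = qpoch2 p q (p * q / x) / qpoch2 p q x"
proof -
  have conv: "convergent_prod (\<lambda>k. 1 - q ^ k * y)" for y
    by (rule convergent_prod_qprod[OF assms(2) one_minus_entire]) simp
  have "ell_gamma p q x = (\<Prod>j. \<Prod>k. (1 - q ^ k * (p ^ j * (p * q / x))) / (1 - q ^ k * (p ^ j * x)))"
    unfolding ell_gamma_def by (intro prodinf_cong) (simp add: mult_ac divide_inverse)
  also have "\<dots> = (\<Prod>j. qpoch q (p ^ j * (p * q / x)) / qpoch q (p ^ j * x))"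
    unfolding qprod_def by (intro prodinf_cong prodinf_divide[symmetric] conv)
  also have "\<dots> = qpoch2 p q (p * q / x) / qpoch2 p q x"
    unfolding qprod_def[of p]
    by (intro prodinf_divide[symmetric] convergent_prod_qprod assms qpoch_entire qpoch_0)
  finally show ?thesis .
qed

lemma norm_power_mult_less_1:
  fixes p :: complex
  assumes "norm p < 1" "norm x < 1"
  shows "norm (p ^ k * x) < 1"
proof -
  have "norm (p ^ k * x) \<le> norm x"
    using assms by (simp add: norm_mult norm_power mult_left_le_one_le power_le_one)
  then show ?thesis using assms by linarith
qed

lemma qpoch_nz:
  assumes "norm p < 1" "norm x < 1"
  shows "qpoch p x \<noteq> 0"
  using norm_power_mult_less_1[OF assms]
  by (auto simp: qpoch_eq_0_iff[OF assms(1)]) (metis norm_one less_irrefl)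

lemma qpoch2_nz:
  assumes "norm p < 1" "norm q < 1" "norm x < 1"
  shows "qpoch2 p q x \<noteq> 0"
  using norm_power_mult_less_1[OF assms(2) norm_power_mult_less_1[OF assms(1,3)]]
  by (auto simp: qpoch2_eq_0_iff[OF assms(1,2)]) (metis norm_one less_irrefl)

text \<open>Passing to \<open>q * x\<close> puts \<open>qpoch p (p / x)\<close> into the numerator
  and takes \<open>qpoch p x\<close> out of the denominator; together they are
  \<open>theta p x\<close>. The bound on \<open>x\<close> makes \<open>qpoch p x\<close> nonzero, so
  that it may be cancelled.\<close>

lemma ell_gamma_shift:
  assumes "norm p < 1" "norm q < 1" "norm x < 1" "q \<noteq> 0" "x \<noteq> 0"
  shows "ell_gamma p q (q * x) = theta p x * ell_gamma p q x"
proof -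
  have "qpoch2 p q (p * q / (q * x)) = qpoch p (p / x) * qpoch2 p q (p * q / x)"
    using qpoch2_shift[OF assms(1,2), of "p / x"] assms by (simp add: mult_ac)
  moreover have "qpoch2 p q x = qpoch p x * qpoch2 p q (q * x)"
    by (rule qpoch2_shift[OF assms(1,2)])
  ultimately show ?thesis
    using qpoch_nz[OF assms(1,3)]
    by (simp add: ell_gamma_eq_qpoch2[OF assms(1,2)] theta_eq_qpoch[OF assms(1)] field_simps)
qed

lemma continuous_on_ell_gamma:
  assumes "norm p < 1" "norm q < 1"
  shows "continuous_on (ball 0 1 - {0}) (ell_gamma p q)"
proof -
  have E: "continuous_on UNIV (qpoch2 p q)"
    by (intro holomorphic_on_imp_continuous_on qpoch2_entire assms)
  show ?thesis unfolding ell_gamma_eq_qpoch2[OF assms]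
    by (intro continuous_on_divide continuous_on_compose2[OF E] continuous_intros)
      (auto simp: qpoch2_nz[OF assms])
qed

text \<open>At \<open>x = 1\<close>, where \<open>ell_gamma\<close> has a pole, \<open>1 / (a / 0) = 0 = 0 / a\<close> is the right value.\<close>

lemma continuous_on_inverse_ell_gamma:
  assumes "norm p < 1" "norm q < 1"
  shows "continuous_on (sphere 0 1) (\<lambda>x. 1 / ell_gamma p q x)"
proof -
  have E: "continuous_on UNIV (qpoch2 p q)"
    by (intro holomorphic_on_imp_continuous_on qpoch2_entire assms)
  have 1: "norm (p * q) < 1"
    using norm_power_mult_less_1[OF assms, of 1] by simp
  have 2: "qpoch2 p q (p * q / x) \<noteq> 0" if "x \<in> sphere 0 1" for x
    using that 1 by (intro qpoch2_nz assms) (auto simp: norm_divide)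
  have 3: "1 / (qpoch2 p q (p * q / x) / qpoch2 p q x) = qpoch2 p q x / qpoch2 p q (p * q / x)" for x
    by simp
  show ?thesis unfolding ell_gamma_eq_qpoch2[OF assms] 3
    by (intro continuous_on_divide continuous_on_compose2[OF E] continuous_intros)
      (use 2 in auto)
qed

section \<open>Functional equations and zeros of the theta function\<close>

lemma open_connected_punctured: "open (- {0::complex})" "connected (- {0::complex})"
  by (auto intro!: connected_punctured_universe)

lemma theta_holomorphic:
  assumes "norm p < 1"
  shows "theta p holomorphic_on - {0}"
proof -
  have "(\<lambda>x. qpoch p (p / x)) holomorphic_on - {0}"
    by (rule holomorphic_on_compose_gen[OF _ qpoch_entire[OF assms], unfolded o_def])
      (auto intro!: holomorphic_intros)
  then show ?thesis
    unfolding theta_eq_qpoch[OF assms]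
    by (intro holomorphic_intros holomorphic_on_subset[OF qpoch_entire[OF assms]]) auto
qed

text \<open>Isolates the zero at 1. The cofactor is invariant under inversion of \<open>x\<close>,
  which gives the reflection formula and, at 1, the derivative.\<close>

lemma theta_split:
  assumes "norm p < 1"
  shows "theta p x = (1 - x) * (qpoch p (p / x) * qpoch p (p * x))"
  using qpoch_step[OF assms, of x] by (simp add: theta_eq_qpoch[OF assms] mult_ac)

lemma theta_1: "norm p < 1 \<Longrightarrow> theta p 1 = 0"
  by (simp add: theta_split)

lemma theta_inverse:
  assumes "norm p < 1" "x \<noteq> 0"
  shows "theta p (1 / x) = - theta p x / x"
  using assms by (simp add: theta_split field_simps)

lemma theta_shift:
  assumes "norm p < 1" "p \<noteq> 0" "x \<noteq> 0"
  shows "theta p (p * x) = - theta p x / x"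
proof -
  have "theta p (p * x) = theta p (1 / x)"
    using assms by (simp add: theta_eq_qpoch mult.commute)
  then show ?thesis using theta_inverse assms by simp
qed

text \<open>Any \<open>b\<close> with \<open>norm p < norm b < 1\<close> has both \<open>b\<close>
  and \<open>p / b\<close> inside the unit disc. It witnesses that \<open>theta p\<close> is not
  identically zero, as needed to isolate its zeros.\<close>

lemma ex_theta_nonzero:
  assumes "norm p < 1"
  obtains b where "b \<noteq> 0" "theta p b \<noteq> 0"
proof
  let ?b = "of_real ((1 + norm p) / 2) :: complex"
  have b: "norm ?b = (1 + norm p) / 2" by (simp only: norm_of_real) simp
  show "?b \<noteq> 0" using b norm_ge_zero[of p] by (metis add_pos_nonneg half_gt_zero less_irrefl norm_zero zero_less_one)
  have "1 + norm p > 0" using norm_ge_zero[of p] by linarith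
  then have "norm ?b < 1" "norm (p / ?b) < 1"
    using assms unfolding norm_divide b by (simp_all add: divide_less_eq)
  then show "theta p ?b \<noteq> 0"
    using qpoch_nz[OF assms] by (simp only: theta_eq_qpoch[OF assms]) simp
qed

text \<open>The codomain of \<open>P\<close> is arbitrary, so one induction covers vanishing along
  an orbit, with boolean \<open>P\<close>, and periodic function values.\<close>

lemma powi_mult_invariant:
  fixes p x :: "'a::field"
  assumes "p \<noteq> 0" "x \<noteq> 0" and P: "\<And>y. y \<noteq> 0 \<Longrightarrow> P (p * y) = P y"
  shows "P (p powi k * x) = P x"
proof (induction k rule: int_induct[where k = 0])
  case (step1 i)
  have "p powi (i + 1) * x = p * (p powi i * x)" using assms by (simp add: power_int_add)
  then have "P (p powi (i + 1) * x) = P (p powi i * x)" using P[of "p powi i * x"] assms by (metis mult_eq_0_iff power_int_not_zero)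
  also have "\<dots> = P x" by (rule step1)
  finally show ?case .
next
  case (step2 i)
  have "p powi i * x = p * (p powi (i - 1) * x)" using assms by (simp add: power_int_diff)
  then have "P (p powi (i - 1) * x) = P (p powi i * x)"
    using P[of "p powi (i - 1) * x"] assms by (metis mult_eq_0_iff power_int_not_zero)
  also have "\<dots> = P x" by (rule step2)
  finally show ?case .
qed simp

context
  fixes p :: complex
  assumes p: "norm p < 1" and p0: "p \<noteq> 0"
begin

lemma theta_powi_mult_eq_0_iff:
  assumes "x \<noteq> 0"
  shows "theta p (p powi k * x) = 0 \<longleftrightarrow> theta p x = 0"
  by (rule powi_mult_invariant[of p x "\<lambda>y. theta p y = 0"])
    (use assms p0 theta_shift[OF p p0] in auto)

lemma theta_eq_0D:
  assumes "x \<noteq> 0" "theta p x = 0"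
  obtains k where "x = p powi k"
proof -
  from assms consider k where "p ^ k * (p / x) = 1" | k where "p ^ k * x = 1"
    using qpoch_eq_0_iff[OF p] by (auto simp: theta_eq_qpoch[OF p])
  then show thesis
  proof cases
    case (1 k)
    then have "p ^ Suc k = x" using assms by (simp add: field_simps)
    then have "x = p powi int (Suc k)" by (simp only: power_int_of_nat)
    then show ?thesis using that by blast
  next
    case (2 k)
    then have "x = p powi (- int k)" using assms p0 by (simp add: field_simps power_int_minus)
    then show ?thesis using that by blast
  qed
qed

text \<open>Differentiates \<open>theta p y = - y * theta p (p * y)\<close>. The term from the
  factor \<open>- y\<close> drops out at a zero.\<close>

lemma deriv_theta_shift:
  assumes "x \<noteq> 0" "theta p x = 0"
  shows "deriv (theta p) x = - x * p * deriv (theta p) (p * x)"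
proof -
  have d: "(theta p has_field_derivative deriv (theta p) y) (at y)" if "y \<noteq> 0" for y
    using that by (intro holomorphic_derivI[OF theta_holomorphic[OF p]]) auto
  have z: "theta p (p * x) = 0" using theta_shift[OF p p0] assms by simp
  have "((\<lambda>y. theta p (p * y)) has_field_derivative deriv (theta p) (p * x) * p) (at x)"
    by (rule DERIV_chain2[OF d]) (use assms p0 in \<open>auto intro!: derivative_eq_intros\<close>)
  then have "((\<lambda>y. - y * theta p (p * y)) has_field_derivative
      - x * (deriv (theta p) (p * x) * p) + - 1 * theta p (p * x)) (at x)"
    by (intro DERIV_mult') (auto intro!: derivative_eq_intros)
  moreover have "((\<lambda>y. - y * theta p (p * y)) has_field_derivative D) (at x)
      \<longleftrightarrow> (theta p has_field_derivative D) (at x)" for D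
  proof (rule DERIV_cong_ev)
    have "eventually (\<lambda>y. y \<in> - {0}) (nhds x)"
      using assms by (intro eventually_nhds_in_open) auto
    then show "eventually (\<lambda>y. - y * theta p (p * y) = theta p y) (nhds x)"
      by eventually_elim (auto simp: theta_shift[OF p p0])
  qed auto
  ultimately have "(theta p has_field_derivative - x * p * deriv (theta p) (p * x)) (at x)"
    by (simp add: z mult_ac)
  then show ?thesis by (rule DERIV_imp_deriv)
qed

text \<open>The zeros are simple. At 1 the derivative is minus the square of
  \<open>qpoch p p\<close>; \<open>deriv_theta_shift\<close> carries nonvanishing to the other
  powers, in both directions.\<close>

lemma deriv_theta_powi_nz:
  "theta p (p powi k) = 0 \<and> deriv (theta p) (p powi k) \<noteq> 0"
proof -
  have z: "theta p (p powi k) = 0" for k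
    using theta_powi_mult_eq_0_iff[of 1 k] theta_1[OF p] by simp
  moreover have "deriv (theta p) (p powi k) \<noteq> 0"
  proof (induction k rule: int_induct[where k = 0])
    case base
    let ?t = "\<lambda>x. qpoch p (p / x) * qpoch p (p * x)"
    have "?t holomorphic_on - {0}"
      by (intro holomorphic_intros holomorphic_on_compose_gen[OF _ qpoch_entire[OF p], unfolded o_def]) auto
    then have "(?t has_field_derivative deriv ?t 1) (at 1)"
      by (intro holomorphic_derivI[of _ "- {0}"]) auto
    then have "((\<lambda>x. (1 - x) * ?t x) has_field_derivative (1 - 1) * deriv ?t 1 + (- 1) * ?t 1) (at 1)"
      by (rule DERIV_mult'[rotated]) (auto intro!: derivative_eq_intros)
    moreover have "theta p = (\<lambda>x. (1 - x) * ?t x)"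
      by (rule ext) (rule theta_split[OF p])
    ultimately have "(theta p has_field_derivative - ?t 1) (at 1)"
      by simp
    then have "deriv (theta p) 1 = - ?t 1" by (rule DERIV_imp_deriv)
    then show ?case using qpoch_nz[OF p, of p] p by simp
  next
    case (step1 i)
    have "p powi (i + 1) = p * p powi i" using p0 by (simp add: power_int_add)
    then show ?case using step1 deriv_theta_shift[OF _ z, of i] p0 by auto
  next
    case (step2 i)
    have "p powi i = p * p powi (i - 1)" using p0 by (simp add: power_int_diff)
    then show ?case using step2 deriv_theta_shift[OF _ z, of "i - 1"] p0 by auto
  qed
  ultimately show ?thesis by blast
qed

text \<open>All zeros of \<open>theta p\<close> are simple and are powers of \<open>p\<close>, so
  \<open>f / theta p\<close> has only removable singularities.\<close>

lemma divide_by_theta_1: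
  assumes f: "f holomorphic_on - {0}" and zero: "\<And>k. f (p powi k) = 0"
  obtains g where "g holomorphic_on - {0}" "\<And>x. x \<noteq> 0 \<Longrightarrow> f x = g x * theta p x"
proof
  \<comment> \<open>At a zero of \<open>theta p\<close> the value is the limit of the quotient by
    l'Hospital's rule.\<close>
  let ?g = "\<lambda>x. if theta p x = 0 then deriv f x / deriv (theta p) x else f x / theta p x"
  have th: "theta p holomorphic_on - {0}" by (rule theta_holomorphic[OF p])
  show "f x = ?g x * theta p x" if x: "x \<noteq> 0" for x
  proof (cases "theta p x = 0")
    case True
    obtain k where "x = p powi k" using theta_eq_0D[OF x True] .
    then show ?thesis using zero True by simp
  qed auto
  have "?g analytic_on {x}" if x: "x \<noteq> 0" for x
  proof (cases "theta p x = 0")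
    case False
    have "open (- {0} \<inter> theta p -` (- {0}))"
      by (intro continuous_open_preimage holomorphic_on_imp_continuous_on th) auto
    moreover have "?g holomorphic_on (- {0} \<inter> theta p -` (- {0}))"
    proof -
      have "(\<lambda>x. f x / theta p x) holomorphic_on (- {0} \<inter> theta p -` (- {0}))"
        by (intro holomorphic_intros holomorphic_on_subset[OF f] holomorphic_on_subset[OF th]) auto
      then show ?thesis by (rule holomorphic_transform) auto
    qed
    ultimately show ?thesis
      using x False by (auto simp: analytic_at)
  next
    case True
    obtain k where k: "x = p powi k" using theta_eq_0D[OF x True] .
    obtain b where b: "b \<noteq> 0" "theta p b \<noteq> 0" using ex_theta_nonzero[OF p] .
    obtain r where r: "0 < r" "ball x r \<subseteq> - {0}" "\<And>z. z \<in> ball x r - {x} \<Longrightarrow> theta p z \<noteq> 0"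
      using isolated_zeros[OF th open_connected_punctured _ True, where \<beta> = b] x b by auto
    define c where "c = deriv f x / deriv (theta p) x"
    have "((\<lambda>w. f w / theta p w) \<longlongrightarrow> c) (at x)"
      by (rule lhopital_complex_simple[where f' = "deriv f x" and g' = "deriv (theta p) x"])
        (use x zero k True deriv_theta_powi_nz in
          \<open>auto intro!: holomorphic_derivI[OF th] holomorphic_derivI[OF f] simp: c_def\<close>)
    then have "(\<lambda>y. if y = x then c else f y / theta p y) holomorphic_on ball x r"
      using r by (intro removable_singularity holomorphic_intros
        holomorphic_on_subset[OF f] holomorphic_on_subset[OF th]) auto
    then have "?g holomorphic_on ball x r"
      by (rule holomorphic_transform) (use r True in \<open>auto simp: c_def\<close>)
    then show ?thesis using r(1) by (meson analytic_at centre_in_ball open_ball)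
  qed
  then have "?g analytic_on - {0}" using analytic_on_analytic_at by blast
  then show "?g holomorphic_on - {0}" by (rule analytic_imp_holomorphic)
qed

lemma divide_by_theta:
  assumes f: "f holomorphic_on - {0}" and zero: "\<And>k. f (p powi k * a) = 0" and a: "a \<noteq> 0"
  obtains g where "g holomorphic_on - {0}" "\<And>x. x \<noteq> 0 \<Longrightarrow> f x = g x * theta p (x / a)"
proof -
  have "(\<lambda>x. f (x * a)) holomorphic_on - {0}"
    by (rule holomorphic_on_compose_gen[OF _ f, unfolded o_def])
      (use a in \<open>auto intro!: holomorphic_intros\<close>)
  then obtain g where g: "g holomorphic_on - {0}" "\<And>x. x \<noteq> 0 \<Longrightarrow> f (x * a) = g x * theta p x"
    using divide_by_theta_1[of "\<lambda>x. f (x * a)"] zero by metis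
  show thesis
  proof (rule that)
    show "(\<lambda>x. g (x / a)) holomorphic_on - {0}"
      by (rule holomorphic_on_compose_gen[OF _ g(1), unfolded o_def])
        (use a in \<open>auto intro!: holomorphic_intros\<close>)
    show "f x = g (x / a) * theta p (x / a)" if "x \<noteq> 0" for x
      using g(2)[of "x / a"] a that by simp
  qed
qed

text \<open>The first quotient still vanishes on the orbit of \<open>b\<close>, because
  \<open>theta p (x / a)\<close> has no zero there.\<close>

lemma divide_by_two_thetas:
  assumes f: "f holomorphic_on - {0}" and zero: "\<And>k. f (p powi k * a) = 0" "\<And>k. f (p powi k * b) = 0"
    and ab: "a \<noteq> 0" "b \<noteq> 0" "theta p (b / a) \<noteq> 0"
  obtains g where "g holomorphic_on - {0}"
    "\<And>x. x \<noteq> 0 \<Longrightarrow> f x = g x * (theta p (x / a) * theta p (x / b))"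
proof -
  obtain g where g: "g holomorphic_on - {0}" "\<And>x. x \<noteq> 0 \<Longrightarrow> f x = g x * theta p (x / a)"
    using divide_by_theta[OF f zero(1) ab(1)] by metis
  have "g (p powi k * b) = 0" for k
    using zero(2)[of k] g(2)[of "p powi k * b"] theta_powi_mult_eq_0_iff[of "b / a" k] ab p0 by simp
  then obtain h where h: "h holomorphic_on - {0}" "\<And>x. x \<noteq> 0 \<Longrightarrow> g x = h x * theta p (x / b)"
    using divide_by_theta[OF g(1) _ ab(2)] by metis
  show thesis by (rule that[OF h(1)]) (simp add: g(2) h(2))
qed

section \<open>Periodic holomorphic functions on the punctured plane\<close>

lemma powi_into_annulus:
  assumes "x \<noteq> 0"
  obtains k where "norm p \<le> norm (p powi k * x)" "norm (p powi k * x) \<le> 1"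
proof -
  let ?L = "ln (norm p)"
  \<comment> \<open>\<open>u\<close> is the logarithm of \<open>norm x\<close> to base
    \<open>norm p\<close>. Taking \<open>k = - \<lfloor>u\<rfloor>\<close> leaves the modulus
    \<open>norm p\<close> to the power \<open>frac u\<close>.\<close>
  define u where "u = ln (norm x) / ?L"
  define k where "k = - \<lfloor>u\<rfloor>"
  have L: "?L < 0" using p p0 by simp
  have "norm (p powi k * x) = norm p powr k * norm x"
    using p0 by (simp add: norm_mult norm_power_int powr_real_of_int')
  also have "\<dots> = exp (k * ?L + ln (norm x))"
    using p0 assms by (simp add: powr_def exp_add)
  also have "k * ?L + ln (norm x) = frac u * ?L"
    using L by (simp add: u_def k_def frac_def field_simps)
  finally have n: "norm (p powi k * x) = exp (frac u * ?L)" .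
  have "frac u * ?L \<le> 0" using L by (intro mult_nonneg_nonpos) auto
  moreover have "1 * ?L \<le> frac u * ?L"
    using L frac_lt_1[of u] by (intro mult_right_mono_neg) auto
  then have "exp ?L \<le> exp (frac u * ?L)" by simp
  then have "norm p \<le> exp (frac u * ?L)" using p0 by simp
  ultimately show thesis using n that[of k] by simp
qed

text \<open>The annulus meets every orbit, so \<open>S\<close> is bounded by its values on a compact
  set. Then \<open>S\<close> composed with \<open>exp\<close> is a bounded entire function, and
  \<open>exp\<close> reaches every nonzero number.\<close>

lemma q_periodic_constant:
  assumes S: "S holomorphic_on - {0}" and per: "\<And>x. x \<noteq> 0 \<Longrightarrow> S (p * x) = S x"
    and "x \<noteq> 0" "y \<noteq> 0"
  shows "S x = S y"
proof -
  have perk: "S (p powi k * x) = S x" if "x \<noteq> 0" for k x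
    by (rule powi_mult_invariant[where P = S, OF p0 that per])
  let ?A = "cball 0 1 - ball 0 (norm p) :: complex set"
  have "continuous_on ?A S"
    using p0 by (intro holomorphic_on_imp_continuous_on holomorphic_on_subset[OF S]) auto
  then have "compact (S ` ?A)"
    by (intro compact_continuous_image compact_diff) auto
  then obtain B where B: "\<And>x. x \<in> ?A \<Longrightarrow> norm (S x) \<le> B"
    by (meson bounded_iff compact_imp_bounded image_eqI)
  have bd: "norm (S x) \<le> B" if "x \<noteq> 0" for x
  proof -
    obtain k where k: "norm p \<le> norm (p powi k * x)" "norm (p powi k * x) \<le> 1"
      by (rule powi_into_annulus[OF \<open>x \<noteq> 0\<close>])
    have "p powi k * x \<in> ?A" using k by auto
    from B[OF this] show ?thesis using perk[OF \<open>x \<noteq> 0\<close>] by simp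
  qed
  have "(\<lambda>u. S (exp u)) holomorphic_on UNIV"
    by (rule holomorphic_on_compose_gen[OF _ S, unfolded o_def]) (auto intro!: holomorphic_intros)
  moreover have "bounded (range (\<lambda>u. S (exp u)))"
    by (rule boundedI[where B = B]) (use bd in auto)
  ultimately have "(\<lambda>u. S (exp u)) constant_on UNIV" by (rule Liouville_theorem)
  then have "S (exp (Ln x)) = S (exp (Ln y))" unfolding constant_on_def by (metis UNIV_I)
  then show ?thesis using assms by simp
qed

end

section \<open>The theta function identity\<close>

text \<open>The factor \<open>1 / x\<close> makes the product antisymmetric. It is the elliptic
  counterpart of \<open>(x + 1 / x) - (y + 1 / y)\<close>, to which it reduces at
  \<open>p = 0\<close>.\<close>

definition theta_bracket :: "complex \<Rightarrow> complex \<Rightarrow> complex \<Rightarrow> complex" where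
  "theta_bracket p x y = theta p (x * y) * theta p (x / y) / x"

lemma theta_bracket_antisym:
  assumes "norm p < 1" "x \<noteq> 0" "y \<noteq> 0"
  shows "theta_bracket p y x = - theta_bracket p x y"
  using theta_inverse[OF assms(1), of "x / y"] assms
  by (simp add: theta_bracket_def mult.commute)

lemma theta_bracket_self: "norm p < 1 \<Longrightarrow> x \<noteq> 0 \<Longrightarrow> theta_bracket p x x = 0"
  by (simp add: theta_bracket_def theta_1)

text \<open>The multiplier \<open>1 / (p * x\<^sup>2)\<close> does not involve \<open>a\<close>, so
  linear combinations of brackets with different \<open>a\<close> share it.\<close>

lemma theta_bracket_shift:
  assumes "norm p < 1" "p \<noteq> 0" "a \<noteq> 0" "x \<noteq> 0"
  shows "theta_bracket p a (p * x) = theta_bracket p a x / (p * x\<^sup>2)"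
proof -
  have 1: "theta p (a * (p * x)) = - theta p (a * x) / (a * x)"
    using theta_shift[OF assms(1,2), of "a * x"] assms by (simp add: mult_ac)
  have "theta p (a / x) = - theta p (a / (p * x)) * (p * x) / a"
    using theta_shift[OF assms(1,2), of "a / (p * x)"] assms by simp
  then have 2: "theta p (a / (p * x)) = - theta p (a / x) * a / (p * x)"
    using assms by simp
  show ?thesis
    unfolding theta_bracket_def 1 2 using assms by (simp add: power2_eq_square)
qed

lemma theta_bracket_inverse: "theta_bracket p a (1 / x) = theta_bracket p a x"
  by (simp add: theta_bracket_def)

lemma theta_bracket_holomorphic:
  assumes "norm p < 1" "a \<noteq> 0"
  shows "theta_bracket p a holomorphic_on - {0}"
  unfolding theta_bracket_def[abs_def]
  by (intro holomorphic_intros holomorphic_on_compose_gen[OF _ theta_holomorphic[OF assms(1)], unfolded o_def])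
    (use assms in auto)

lemma theta_bracket_nzD:
  assumes "theta_bracket p a b \<noteq> 0"
  shows "theta p (a * b) \<noteq> 0" "theta p (a / b) \<noteq> 0"
  using assms by (auto simp: theta_bracket_def)

text \<open>The left side \<open>P\<close> is invariant under \<open>x \<mapsto> 1/x\<close> and vanishes at \<open>a\<close>, \<open>b\<close> and \<open>c\<close>. So
  \<open>(x P(x))\<^sup>2\<close> divided by \<open>\<theta>(x/a) \<theta>(x/b) \<theta>(xa) \<theta>(xb)\<close> has no poles and is \<open>p\<close>-periodic, hence
  constant, and it vanishes at \<open>c\<close>. Squaring makes the signs of the quasi-periods cancel.\<close>

lemma theta_bracket_relation:
  assumes p: "norm p < 1" and nz: "a \<noteq> 0" "b \<noteq> 0" "c \<noteq> 0" "x \<noteq> 0"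
    and br: "theta_bracket p a b \<noteq> 0" "theta_bracket p b c \<noteq> 0" "theta_bracket p a c \<noteq> 0"
  shows "theta_bracket p a x * theta_bracket p b c - theta_bracket p a c * theta_bracket p b x
    + theta_bracket p a b * theta_bracket p c x = 0"
proof (cases "p = 0")
  \<comment> \<open>Here the bracket is a difference \<open>h u - h v\<close> with
    \<open>h u = u + 1 / u\<close>, and for such differences the relation is an algebraic
    identity.\<close>
  case True
  have theta_0: "theta 0 y = 1 - y" for y
    using qpoch_step[of 0] by (simp add: theta_eq_qpoch qpoch_0)
  have br_0: "theta_bracket 0 u v = (u + 1 / u) - (v + 1 / v)" if "u \<noteq> 0" "v \<noteq> 0" for u v
    using that unfolding theta_bracket_def theta_0 by (simp add: field_simps)
  show ?thesis
    unfolding True br_0[OF nz(1,2)] br_0[OF nz(1,3)] br_0[OF nz(1,4)] br_0[OF nz(2,3)] br_0[OF nz(2,4)] br_0[OF nz(3,4)]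
    by (simp add: algebra_simps)
next
  case p0: False
  let ?B = "theta_bracket p"
  define P where "P x = ?B a x * ?B b c - ?B a c * ?B b x + ?B a b * ?B c x" for x
  note anti = theta_bracket_antisym[OF p]
  have Pz: "P a = 0" "P b = 0" "P c = 0"
    unfolding P_def using anti[of a b] anti[of b c] anti[of a c] nz
    by (auto simp: theta_bracket_self[OF p])
  have Pinv: "P (1 / y) = P y" for y
    unfolding P_def theta_bracket_inverse ..
  have Pshift: "P (p * y) = P y / (p * y\<^sup>2)" if "y \<noteq> 0" for y
    unfolding P_def using that nz by (simp add: theta_bracket_shift[OF p p0] add_divide_distrib diff_divide_distrib)
  have Pk: "P (p powi k * y) = 0" if y: "P y = 0" "y \<noteq> 0" for k y
    using powi_mult_invariant[of p y "\<lambda>y. P y = 0" k] Pshift y p0 by auto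
  \<comment> \<open>The factor \<open>y\<close> absorbs the \<open>p\<close> of the multiplier:
    \<open>H (p * y) = H y / y\<^sup>2\<close>, whose square matches the multiplier of
    \<open>D\<close>.\<close>
  define H where "H y = y * P y" for y
  have H: "H holomorphic_on - {0}"
    unfolding H_def P_def
    by (intro holomorphic_intros theta_bracket_holomorphic[OF p]) (use nz in auto)
  have Hk: "H (p powi k * y) = 0" if "P y = 0" "y \<noteq> 0" for k y
    using Pk[OF that] by (simp add: H_def)
  have ba: "theta p (b / a) \<noteq> 0"
    using theta_inverse[OF p, of "a / b"] theta_bracket_nzD(2)[OF br(1)] nz by simp
  obtain g1 where g1: "g1 holomorphic_on - {0}"
    "\<And>y. y \<noteq> 0 \<Longrightarrow> H y = g1 y * (theta p (y / a) * theta p (y / b))"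
    using divide_by_two_thetas[OF p p0 H Hk[OF Pz(1)] Hk[OF Pz(2)] nz(1,2) ba] nz by metis
  \<comment> \<open>The zeros at \<open>1 / a\<close> and \<open>1 / b\<close> come from
    \<open>Pinv\<close>. They get a quotient of their own because \<open>1 / a\<close> may lie on
    the orbit of \<open>a\<close>, and likewise for \<open>b\<close>, where a single zero of
    \<open>H\<close> need not allow two divisions. In \<open>(H y)\<^sup>2\<close> each pair uses
    its own factor \<open>H y\<close>.\<close>
  have ba': "theta p ((1 / b) / (1 / a)) \<noteq> 0"
    using theta_bracket_nzD(2)[OF br(1)] by simp
  obtain g2 where g2: "g2 holomorphic_on - {0}"
    "\<And>y. y \<noteq> 0 \<Longrightarrow> H y = g2 y * (theta p (y / (1 / a)) * theta p (y / (1 / b)))"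
    using divide_by_two_thetas[OF p p0 H Hk[of "1/a"] Hk[of "1/b"] _ _ ba'] nz Pinv Pz by (metis divide_eq_0_iff one_neq_zero)
  define D where "D y = theta p (y / a) * theta p (y / b) * theta p (y * a) * theta p (y * b)" for y
  define S where "S y = g1 y * g2 y" for y
  have SD: "S y * D y = (H y)\<^sup>2" if "y \<noteq> 0" for y
  proof -
    have "(H y)\<^sup>2 = (g1 y * (theta p (y / a) * theta p (y / b))) * (g2 y * (theta p (y / (1 / a)) * theta p (y / (1 / b))))"
      using g1(2)[OF that] g2(2)[OF that] by (simp only: power2_eq_square)
    then show ?thesis by (simp add: S_def D_def)
  qed
  have S: "S holomorphic_on - {0}"
    unfolding S_def by (intro holomorphic_intros g1 g2)
  have Dsh: "D (p * y) = D y / y ^ 4" if "y \<noteq> 0" for y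
  proof -
    have "theta p (p * y / a) = - theta p (y / a) / (y / a)" "theta p (p * y / b) = - theta p (y / b) / (y / b)"
      "theta p (p * y * a) = - theta p (y * a) / (y * a)" "theta p (p * y * b) = - theta p (y * b) / (y * b)"
      using that nz theta_shift[OF p p0, of "y / a"] theta_shift[OF p p0, of "y / b"]
        theta_shift[OF p p0, of "y * a"] theta_shift[OF p p0, of "y * b"]
      by (simp_all add: mult.assoc)
    then show ?thesis
      using that nz by (simp add: D_def power4_eq_xxxx) (simp add: mult.assoc)
  qed
  have Dh: "D holomorphic_on - {0}"
    unfolding D_def
    by (intro holomorphic_intros holomorphic_on_compose_gen[OF _ theta_holomorphic[OF p], unfolded o_def])
      (use nz in auto)
  have Dc: "D c \<noteq> 0"
    using theta_bracket_nzD[OF br(2)] theta_bracket_nzD[OF br(3)] nz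
      theta_inverse[OF p, of "a / c"] theta_inverse[OF p, of "b / c"]
    by (auto simp: D_def mult.commute)
  have Hsh: "(H (p * y))\<^sup>2 = (H y)\<^sup>2 / y ^ 4" if "y \<noteq> 0" for y
    using that p0 by (simp add: H_def Pshift power2_eq_square power4_eq_xxxx)
  \<comment> \<open>Cancelling \<open>D\<close> is possible only where it is nonzero. This open set
    contains \<open>c\<close>, and analytic continuation on the connected punctured plane does the
    rest.\<close>
  have Sper: "S (p * y) = S y" if "y \<noteq> 0" for y
  proof (rule analytic_continuation_open[where f = "\<lambda>y. S (p * y)" and g = S])
    let ?U = "- {0} \<inter> D -` (- {0})"
    show "open ?U"
      by (intro continuous_open_preimage holomorphic_on_imp_continuous_on Dh) auto
    show "?U \<noteq> {}" using nz(3) Dc by auto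
    show "S (p * z) = S z" if "z \<in> ?U" for z
    proof -
      have z: "z \<noteq> 0" "D z \<noteq> 0" using that by auto
      have "S (p * z) * (D z / z ^ 4) = S z * D z / z ^ 4"
        using SD[of "p * z"] SD[of z] Hsh[OF z(1)] Dsh[OF z(1)] z p0 by simp
      then show ?thesis using z by simp
    qed
    show "(\<lambda>y. S (p * y)) holomorphic_on - {0}"
      by (rule holomorphic_on_compose_gen[OF _ S, unfolded o_def])
        (use p0 in \<open>auto intro!: holomorphic_intros\<close>)
  qed (use that S open_connected_punctured in auto)
  have "S c = 0" using SD[OF nz(3)] Dc Pz by (simp add: H_def)
  then have "S x = 0" using q_periodic_constant[OF p p0 S Sper] nz by metis
  then have "H x = 0" using SD[OF nz(4)] by simp
  then show ?thesis using nz by (simp add: H_def P_def)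
qed

text \<open>Induction on \<open>K\<close>. The relation writes \<open>G i z\<close> as a combination
  of \<open>F i b\<close> and \<open>F i a\<close> with coefficients free of \<open>i\<close>. A
  factor \<open>F i c\<close> kills the summand \<open>i = c\<close> and cancels the denominator
  factor \<open>j = c\<close> in the others, which leaves the same sum for \<open>K\<close> and
  \<open>T - {c}\<close>. Once \<open>K\<close> is used up, two summands remain and cancel by
  antisymmetry.\<close>

lemma sum_prod_bracket_eq_0:
  fixes F :: "'i \<Rightarrow> 'i \<Rightarrow> 'f::field" and G :: "'i \<Rightarrow> 'k \<Rightarrow> 'f"
  assumes "finite K" "finite T" "card T = card K + 2"
    and "\<And>i j. i \<in> T \<Longrightarrow> j \<in> T \<Longrightarrow> F j i = - F i j"
    and "\<And>i j. i \<in> T \<Longrightarrow> j \<in> T \<Longrightarrow> i \<noteq> j \<Longrightarrow> F i j \<noteq> 0"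
    and "\<And>i. i \<in> T \<Longrightarrow> F i i = 0"
    and "\<And>i a b k. \<lbrakk>i \<in> T; a \<in> T; b \<in> T; i \<noteq> a; i \<noteq> b; a \<noteq> b; k \<in> K\<rbrakk> \<Longrightarrow>
      G i k * F a b - F i b * G a k + F i a * G b k = 0"
  shows "(\<Sum>i\<in>T. (\<Prod>k\<in>K. G i k) / (\<Prod>j\<in>T - {i}. F i j)) = 0"
  using assms
proof (induction K arbitrary: T rule: finite_induct)
  case empty
  have "card T = 2" using empty.prems(2) by simp
  then obtain a b where T: "T = {a, b}" "a \<noteq> b" using card_2_iff by metis
  then have "T - {a} = {b}" "T - {b} = {a}" by auto
  moreover have "F b a = - F a b" using T by (intro empty.prems(3)) auto
  moreover have "F a b \<noteq> 0" using T by (intro empty.prems(4)) auto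
  ultimately show ?case using T by (simp add: divide_simps)
next
  case (insert z K)
  have "\<not> card T \<le> Suc 0" using insert.prems(2) insert.hyps by simp
  then obtain a b where ab: "a \<in> T" "b \<in> T" "a \<noteq> b"
    using card_le_Suc0_iff_eq[OF insert.prems(1)] by blast
  have Fab: "F a b \<noteq> 0" using ab by (intro insert.prems(4))
  have rel: "G i z = (F i b * G a z - F i a * G b z) / F a b" if "i \<in> T" for i
  proof -
    have Faa: "F a a = 0" "F b b = 0" "F b a = - F a b"
      using ab by (auto intro: insert.prems)
    have "G i z * F a b - F i b * G a z + F i a * G b z = 0"
    proof (cases "i = a \<or> i = b")
      case True
      then show ?thesis using Faa by auto
    next
      case False
      then show ?thesis using ab insert.prems(6)[of i a b z] that by auto
    qed
    then show ?thesis using Fab by (simp add: field_simps)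
  qed
  have part: "(\<Sum>i\<in>T. (\<Prod>k\<in>K. G i k) * F i c / (\<Prod>j\<in>T - {i}. F i j)) = 0" if c: "c \<in> T" for c
  proof -
    have "(\<Sum>i\<in>T. (\<Prod>k\<in>K. G i k) * F i c / (\<Prod>j\<in>T - {i}. F i j)) =
      (\<Sum>i\<in>T - {c}. (\<Prod>k\<in>K. G i k) * F i c / (\<Prod>j\<in>T - {i}. F i j))"
      using c insert.prems(1,5) by (intro sum.mono_neutral_right) auto
    also have "\<dots> = (\<Sum>i\<in>T - {c}. (\<Prod>k\<in>K. G i k) / (\<Prod>j\<in>(T - {c}) - {i}. F i j))"
    proof (rule sum.cong[OF refl])
      fix i assume i: "i \<in> T - {c}"
      have "(\<Prod>j\<in>T - {i}. F i j) = F i c * (\<Prod>j\<in>T - {i} - {c}. F i j)"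
        using i c insert.prems(1) by (intro prod.remove) auto
      moreover have "T - {i} - {c} = (T - {c}) - {i}" by auto
      moreover have "F i c \<noteq> 0" using i c by (intro insert.prems(4)) auto
      ultimately show "(\<Prod>k\<in>K. G i k) * F i c / (\<Prod>j\<in>T - {i}. F i j) =
        (\<Prod>k\<in>K. G i k) / (\<Prod>j\<in>(T - {c}) - {i}. F i j)" by simp
    qed
    also have "\<dots> = 0"
    proof (rule insert.IH)
      show "card (T - {c}) = card K + 2" using insert.prems(1,2) insert.hyps c by simp
      show "F j i = - F i j" if "i \<in> T - {c}" "j \<in> T - {c}" for i j
        using that by (intro insert.prems(3)) auto
    qed (use insert.prems(1,4,5,6) in auto)
    finally show ?thesis .
  qed
  have "(\<Sum>i\<in>T. (\<Prod>k\<in>insert z K. G i k) / (\<Prod>j\<in>T - {i}. F i j)) =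
    (\<Sum>i\<in>T. G a z / F a b * ((\<Prod>k\<in>K. G i k) * F i b / (\<Prod>j\<in>T - {i}. F i j))
       - G b z / F a b * ((\<Prod>k\<in>K. G i k) * F i a / (\<Prod>j\<in>T - {i}. F i j)))"
  proof (rule sum.cong[OF refl])
    fix i assume i: "i \<in> T"
    have e: "(\<Prod>k\<in>insert z K. G i k) = G i z * (\<Prod>k\<in>K. G i k)" using insert.hyps by simp
    show "(\<Prod>k\<in>insert z K. G i k) / (\<Prod>j\<in>T - {i}. F i j) =
      G a z / F a b * ((\<Prod>k\<in>K. G i k) * F i b / (\<Prod>j\<in>T - {i}. F i j))
       - G b z / F a b * ((\<Prod>k\<in>K. G i k) * F i a / (\<Prod>j\<in>T - {i}. F i j))"
      unfolding e rel[OF i]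
      by (simp add: diff_divide_distrib left_diff_distrib right_diff_distrib mult_ac)
  qed
  also have "\<dots> = 0"
    unfolding sum_subtractf sum_distrib_left[symmetric] part[OF ab(1)] part[OF ab(2)] by simp
  finally show ?case .
qed

lemma theta_partial_fraction_identity:
  assumes p: "norm p < 1" and fin: "finite K" "finite T" "card T = card K + 2"
    and nz: "\<And>i. i \<in> T \<Longrightarrow> u i \<noteq> 0" "\<And>k. k \<in> K \<Longrightarrow> z k \<noteq> 0"
    and th: "\<And>i j. i \<in> T \<Longrightarrow> j \<in> T \<Longrightarrow> i \<noteq> j \<Longrightarrow> theta p (u i * u j) * theta p (u i / u j) \<noteq> 0"
  shows "(\<Sum>i\<in>T. u i * (\<Prod>k\<in>K. theta p (u i * z k) * theta p (u i / z k)) /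
           (\<Prod>j\<in>T - {i}. theta p (u i * u j) * theta p (u i / u j))) = 0"
proof -
  let ?B = "theta_bracket p"
  have "(\<Sum>i\<in>T. (\<Prod>k\<in>K. ?B (u i) (z k)) / (\<Prod>j\<in>T - {i}. ?B (u i) (u j))) = 0"
  proof (rule sum_prod_bracket_eq_0[OF fin])
    show B: "?B (u i) (u j) \<noteq> 0" if "i \<in> T" "j \<in> T" "i \<noteq> j" for i j
      using th[OF that] nz that by (simp add: theta_bracket_def)
    show "?B (u i) (z k) * ?B (u a) (u b) - ?B (u i) (u b) * ?B (u a) (z k)
      + ?B (u i) (u a) * ?B (u b) (z k) = 0"
      if "i \<in> T" "a \<in> T" "b \<in> T" "i \<noteq> a" "i \<noteq> b" "a \<noteq> b" "k \<in> K" for i a b k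
      by (rule theta_bracket_relation[OF p]) (use that nz B in auto)
    show "?B (u j) (u i) = - ?B (u i) (u j)" if "i \<in> T" "j \<in> T" for i j
      using that by (intro theta_bracket_antisym[OF p] nz)
    show "?B (u i) (u i) = 0" if "i \<in> T" for i
      using that by (intro theta_bracket_self[OF p] nz)
  qed
  \<comment> \<open>Each bracket carries a factor \<open>1 / u i\<close>: \<open>card K\<close> of
    them above and \<open>card K + 1\<close> below leave one \<open>u i\<close>.\<close>
  moreover have "(\<Prod>k\<in>K. ?B (u i) (z k)) / (\<Prod>j\<in>T - {i}. ?B (u i) (u j)) =
    u i * (\<Prod>k\<in>K. theta p (u i * z k) * theta p (u i / z k)) /
           (\<Prod>j\<in>T - {i}. theta p (u i * u j) * theta p (u i / u j))" if "i \<in> T" for i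
    using that fin nz by (simp add: theta_bracket_def prod_dividef card_Diff_singleton)
  ultimately show ?thesis by simp
qed

section \<open>Holomorphic and meromorphic functions of several variables\<close>

lemma mv_holomorphic_on_subset: "mv_holomorphic_on f U \<Longrightarrow> V \<subseteq> U \<Longrightarrow> mv_holomorphic_on f V"
  unfolding mv_holomorphic_on_def by blast

lemma mv_holomorphic_on_imp_isCont: "mv_holomorphic_on f U \<Longrightarrow> x \<in> U \<Longrightarrow> isCont f x"
  unfolding mv_holomorphic_on_def using has_derivative_continuous by blast

lemma mv_holomorphic_on_imp_continuous_on: "mv_holomorphic_on f U \<Longrightarrow> continuous_on U f"
  by (simp add: continuous_at_imp_continuous_on mv_holomorphic_on_imp_isCont)

lemma mv_holomorphic_on_const: "mv_holomorphic_on (\<lambda>x. c) U"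
  unfolding mv_holomorphic_on_def by (auto intro!: exI[of _ "\<lambda>x. 0"])

lemma mv_holomorphic_on_component: "mv_holomorphic_on (\<lambda>x. x $ i) U"
  unfolding mv_holomorphic_on_def
  by (auto intro!: exI[of _ "\<lambda>x. x $ i"] bounded_linear_imp_has_derivative bounded_linear_vec_nth)

lemma mv_holomorphic_on_add:
  assumes "mv_holomorphic_on f U" "mv_holomorphic_on g U"
  shows "mv_holomorphic_on (\<lambda>x. f x + g x) U"
  unfolding mv_holomorphic_on_def
proof
  fix x assume "x \<in> U"
  then obtain f' g' where *: "(f has_derivative f') (at x)" "\<And>c v. f' (c *s v) = c * f' v"
    "(g has_derivative g') (at x)" "\<And>c v. g' (c *s v) = c * g' v"
    using assms unfolding mv_holomorphic_on_def by metis
  show "\<exists>h'. ((\<lambda>x. f x + g x) has_derivative h') (at x) \<and> (\<forall>c v. h' (c *s v) = c * h' v)"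
    by (rule exI, rule conjI, rule has_derivative_add[OF *(1,3)]) (simp add: * algebra_simps)
qed

lemma mv_holomorphic_on_mult:
  assumes "mv_holomorphic_on f U" "mv_holomorphic_on g U"
  shows "mv_holomorphic_on (\<lambda>x. f x * g x) U"
  unfolding mv_holomorphic_on_def
proof
  fix x assume "x \<in> U"
  then obtain f' g' where *: "(f has_derivative f') (at x)" "\<And>c v. f' (c *s v) = c * f' v"
    "(g has_derivative g') (at x)" "\<And>c v. g' (c *s v) = c * g' v"
    using assms unfolding mv_holomorphic_on_def by metis
  show "\<exists>h'. ((\<lambda>x. f x * g x) has_derivative h') (at x) \<and> (\<forall>c v. h' (c *s v) = c * h' v)"
    by (rule exI, rule conjI, rule has_derivative_mult[OF *(1,3)]) (simp add: * algebra_simps)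
qed

lemma mv_holomorphic_on_prod:
  assumes "\<And>i. i \<in> I \<Longrightarrow> mv_holomorphic_on (f i) U"
  shows "mv_holomorphic_on (\<lambda>x. \<Prod>i\<in>I. f i x) U"
  using assms
  by (induction I rule: infinite_finite_induct) (auto intro!: mv_holomorphic_on_const mv_holomorphic_on_mult)

lemma mv_holomorphic_on_compose:
  assumes g: "mv_holomorphic_on g U" and f: "f holomorphic_on S" "open S" "\<And>x. x \<in> U \<Longrightarrow> g x \<in> S"
  shows "mv_holomorphic_on (\<lambda>x. f (g x)) U"
  unfolding mv_holomorphic_on_def
proof
  fix x assume x: "x \<in> U"
  then obtain g' where *: "(g has_derivative g') (at x)" "\<And>c v. g' (c *s v) = c * g' v"
    using g unfolding mv_holomorphic_on_def by metis
  have "(f has_derivative (*) (deriv f (g x))) (at (g x))"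
    using holomorphic_derivI[OF f(1,2) f(3)[OF x]] by (simp add: has_field_derivative_def)
  from has_derivative_compose[OF *(1) this]
  show "\<exists>h'. ((\<lambda>x. f (g x)) has_derivative h') (at x) \<and> (\<forall>c v. h' (c *s v) = c * h' v)"
    by (rule_tac exI, rule_tac conjI, assumption) (simp add: *)
qed

lemma mv_holomorphic_on_linear_compose:
  assumes f: "mv_holomorphic_on f U" and T: "bounded_linear T" "\<And>c v. T (c *s v) = c *s T v"
    and sub: "\<And>x. x \<in> V \<Longrightarrow> T x \<in> U"
  shows "mv_holomorphic_on (\<lambda>x. f (T x)) V"
  unfolding mv_holomorphic_on_def
proof
  fix x assume x: "x \<in> V"
  then obtain f' where *: "(f has_derivative f') (at (T x))" "\<And>c v. f' (c *s v) = c * f' v"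
    using f sub unfolding mv_holomorphic_on_def by metis
  from has_derivative_compose[OF bounded_linear_imp_has_derivative[OF T(1)] *(1)]
  show "\<exists>h'. ((\<lambda>x. f (T x)) has_derivative h') (at x) \<and> (\<forall>c v. h' (c *s v) = c * h' v)"
    by (rule_tac exI, rule_tac conjI, assumption) (simp add: * T)
qed

lemma bounded_linear_smult_vec: "bounded_linear (\<lambda>t::complex. t *s (v :: complex^'n))"
proof -
  have "linear (\<lambda>t::complex. t *s v)"
    by (rule linearI) (auto simp: vec_eq_iff algebra_simps)
  then show ?thesis by (simp add: linear_conv_bounded_linear)
qed

lemma mv_holomorphic_on_complex_line:
  assumes f: "mv_holomorphic_on f U" and "open S" "\<And>t. t \<in> S \<Longrightarrow> y + t *s v \<in> U"
  shows "(\<lambda>t. f (y + t *s v)) holomorphic_on S"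
proof -
  have "(\<lambda>t. f (y + t *s v)) field_differentiable at t" if t: "t \<in> S" for t
  proof -
    obtain f' where *: "(f has_derivative f') (at (y + t *s v))" "\<And>c v. f' (c *s v) = c * f' v"
      using f assms(3)[OF t] unfolding mv_holomorphic_on_def by metis
    have "((\<lambda>t. y + t *s v) has_derivative (\<lambda>h. 0 + h *s v)) (at t)"
      by (intro has_derivative_add has_derivative_const bounded_linear_imp_has_derivative bounded_linear_smult_vec)
    then have "((\<lambda>t. f (y + t *s v)) has_derivative (\<lambda>h. f' (0 + h *s v))) (at t)"
      using *(1) by (rule has_derivative_compose)
    moreover have "(\<lambda>h. f' (0 + h *s v)) = (*) (f' v)" by (auto simp: * mult.commute)
    ultimately show ?thesis
      unfolding field_differentiable_def has_field_derivative_def by auto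
  qed
  then show ?thesis by (simp add: holomorphic_on_def field_differentiable_at_within)
qed

text \<open>One-variable identity theorem on the complex line through \<open>y\<close> and
  \<open>w\<close>: the parameters that land in the ball form a convex, hence connected set, and
  \<open>f\<close> vanishes near \<open>y\<close>.\<close>

lemma mv_identity_theorem_ball:
  fixes f :: "complex^'n \<Rightarrow> complex"
  assumes f: "mv_holomorphic_on f (ball x r)" and E: "open E" "y \<in> E" "\<And>z. z \<in> E \<Longrightarrow> f z = 0"
    and y: "y \<in> ball x r" and w: "w \<in> ball x r"
  shows "f w = 0"
proof -
  let ?l = "\<lambda>t. y + t *s (w - y)"
  let ?S = "?l -` ball x r"
  have cont: "continuous_on UNIV ?l"
    by (intro continuous_intros linear_continuous_on bounded_linear_smult_vec)
  have "?l 1 = w" by (simp add: vec_eq_iff)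
  have "f (?l 1) = 0"
  proof (rule analytic_continuation_open[where s' = ?S and f = "\<lambda>t. f (?l t)" and g = "\<lambda>t. 0"])
    show "open (?S \<inter> ?l -` E)" "open ?S"
      using cont E by (auto intro!: open_Int open_vimage)
    have "0 \<in> ?S \<inter> ?l -` E" using y E by simp
    then show "?S \<inter> ?l -` E \<noteq> {}" by blast
    have "convex ?S"
    proof (rule convexI)
      fix s t :: complex and a b :: real
      assume s: "s \<in> ?S" and t: "t \<in> ?S" and ab: "0 \<le> a" "0 \<le> b" "a + b = 1"
      have "a *\<^sub>R ?l s + b *\<^sub>R ?l t \<in> ball x r"
        using convexD[OF convex_ball] s t ab by blast
      moreover have "a *\<^sub>R ?l s + b *\<^sub>R ?l t = (a + b) *\<^sub>R y + (a *\<^sub>R s + b *\<^sub>R t) *s (w - y)"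
        by (simp add: vec_eq_iff scaleR_conv_of_real[where 'a = complex] algebra_simps)
      ultimately show "a *\<^sub>R s + b *\<^sub>R t \<in> ?S" using ab by simp
    qed
    then show "connected ?S" by (rule convex_connected)
    show "(\<lambda>t. f (?l t)) holomorphic_on ?S"
      by (rule mv_holomorphic_on_complex_line[OF f \<open>open ?S\<close>]) auto
    show "1 \<in> ?S" using w by (simp only: vimage_eq \<open>?l 1 = w\<close>)
  qed (use E in auto)
  then show ?thesis by (simp only: \<open>?l 1 = w\<close>)
qed

text \<open>The interior \<open>E\<close> of the zero set is relatively closed: a ball around a
  limit point meets \<open>E\<close>, so \<open>f\<close> vanishes on the whole ball.\<close>

lemma mv_identity_theorem:
  fixes f :: "complex^'n \<Rightarrow> complex"
  assumes f: "mv_holomorphic_on f U" and U: "open U" "connected U"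
    and V: "open V" "V \<noteq> {}" "V \<subseteq> U" "\<And>z. z \<in> V \<Longrightarrow> f z = 0" and x: "x \<in> U"
  shows "f x = 0"
proof -
  define E where "E = interior {z \<in> U. f z = 0}"
  have E: "open E" "\<And>z. z \<in> E \<Longrightarrow> f z = 0"
    unfolding E_def using interior_subset by auto
  have "V \<subseteq> E" unfolding E_def using V by (intro interior_maximal) auto
  have cl: "z \<in> E" if z: "z \<in> U" "z \<in> closure E" for z
  proof -
    obtain r where r: "r > 0" "ball z r \<subseteq> U" using U z by (meson openE)
    obtain y where y: "y \<in> E" "y \<in> ball z r"
      using z(2) r(1) by (auto simp: closure_approachable dist_commute)
    have "f w = 0" if "w \<in> ball z r" for w
      by (rule mv_identity_theorem_ball[OF mv_holomorphic_on_subset[OF f r(2)] E(1) y(1) E(2) y(2) that])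
    then have "ball z r \<subseteq> E"
      unfolding E_def using r by (intro interior_maximal) auto
    then show ?thesis using r by auto
  qed
  have "E \<inter> U = {} \<or> - closure E \<inter> U = {}"
    using cl closure_subset[of E] by (intro connectedD[OF U(2) E(1)]) auto
  moreover have "E \<inter> U \<noteq> {}" using \<open>V \<subseteq> E\<close> V by auto
  ultimately have "x \<in> E" using cl x by auto
  then show ?thesis by (rule E(2))
qed

text \<open>For holomorphic \<open>h\<close> on a nonempty connected open set this amounts to
  \<open>h\<close> not vanishing identically. Unlike that condition it passes to smaller sets, so
  denominators can be restricted to smaller balls and multiplied.\<close>

definition densely_nonzero_on :: "('a::topological_space \<Rightarrow> complex) \<Rightarrow> 'a set \<Rightarrow> bool" where
  "densely_nonzero_on h U \<longleftrightarrow> (\<forall>V. open V \<longrightarrow> V \<noteq> {} \<longrightarrow> V \<subseteq> U \<longrightarrow> (\<exists>y\<in>V. h y \<noteq> 0))"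

lemma densely_nonzero_on_subset: "densely_nonzero_on h U \<Longrightarrow> V \<subseteq> U \<Longrightarrow> densely_nonzero_on h V"
  unfolding densely_nonzero_on_def by (meson order_trans)

lemma densely_nonzero_onD:
  "densely_nonzero_on h U \<Longrightarrow> open V \<Longrightarrow> y \<in> V \<Longrightarrow> V \<subseteq> U \<Longrightarrow> \<exists>y\<in>V. h y \<noteq> 0"
  unfolding densely_nonzero_on_def by blast

lemma mv_holomorphic_nonzero_open:
  assumes "mv_holomorphic_on h U" "open V" "V \<subseteq> U"
  shows "open {y \<in> V. h y \<noteq> 0}"
proof -
  have "open (V \<inter> h -` (- {0}))"
    using assms(2) mv_holomorphic_on_imp_continuous_on[OF mv_holomorphic_on_subset[OF assms(1,3)]]
    by (intro continuous_open_preimage) auto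
  then show ?thesis by (simp add: vimage_def Collect_conj_eq)
qed

lemma densely_nonzero_on_mult:
  assumes "mv_holomorphic_on h U" "densely_nonzero_on h U" "densely_nonzero_on k U"
  shows "densely_nonzero_on (\<lambda>x. h x * k x) U"
  unfolding densely_nonzero_on_def
proof (intro allI impI)
  fix V :: "(complex^'a) set" assume V: "open V" "V \<noteq> {}" "V \<subseteq> U"
  then obtain y where "y \<in> V" "h y \<noteq> 0" using assms(2) unfolding densely_nonzero_on_def by blast
  then have "\<exists>z\<in>{y \<in> V. h y \<noteq> 0}. k z \<noteq> 0"
    using V by (intro densely_nonzero_onD[OF assms(3)] mv_holomorphic_nonzero_open[OF assms(1)]) auto
  then show "\<exists>y\<in>V. h y * k y \<noteq> 0" by auto
qed

text \<open>Concentric balls are nested, so two local quotients can be compared on the smaller one.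
  The identity theorem on the connected \<open>U\<close> upgrades one nonzero value of the
  denominator to a dense set of them.\<close>

lemma mv_meromorphic_on_iff_ball:
  assumes "open D"
  shows "mv_meromorphic_on F D \<longleftrightarrow> (\<forall>x\<in>D. \<exists>r g h. r > 0 \<and> ball x r \<subseteq> D \<and>
    mv_holomorphic_on g (ball x r) \<and> mv_holomorphic_on h (ball x r) \<and> densely_nonzero_on h (ball x r) \<and>
    (\<forall>y\<in>ball x r. h y \<noteq> 0 \<longrightarrow> F y = g y / h y))" (is "?l = ?r")
proof
  assume ?l
  show ?r
  proof
    fix x assume "x \<in> D"
    with \<open>?l\<close> obtain U g h where U: "open U" "connected U" "x \<in> U" "U \<subseteq> D"
      "mv_holomorphic_on g U" "mv_holomorphic_on h U" "\<exists>y\<in>U. h y \<noteq> 0"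
      "\<forall>y\<in>U. h y \<noteq> 0 \<longrightarrow> F y = g y / h y"
      unfolding mv_meromorphic_on_def by meson
    then obtain r where r: "r > 0" "ball x r \<subseteq> U" by (meson openE)
    have "densely_nonzero_on h U"
      unfolding densely_nonzero_on_def using mv_identity_theorem[OF U(6,1,2)] U(7) by blast
    with U r show "\<exists>r g h. r > 0 \<and> ball x r \<subseteq> D \<and>
      mv_holomorphic_on g (ball x r) \<and> mv_holomorphic_on h (ball x r) \<and> densely_nonzero_on h (ball x r) \<and>
      (\<forall>y\<in>ball x r. h y \<noteq> 0 \<longrightarrow> F y = g y / h y)"
      by (intro exI[of _ r] exI[of _ g] exI[of _ h])
        (auto intro: mv_holomorphic_on_subset densely_nonzero_on_subset)
  qed
next
  assume ?r
  show ?l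
    unfolding mv_meromorphic_on_def
  proof
    fix x assume "x \<in> D"
    with \<open>?r\<close> obtain r g h where r: "r > 0" "ball x r \<subseteq> D"
      "mv_holomorphic_on g (ball x r)" "mv_holomorphic_on h (ball x r)" "densely_nonzero_on h (ball x r)"
      "\<forall>y\<in>ball x r. h y \<noteq> 0 \<longrightarrow> F y = g y / h y"
      by meson
    have "\<exists>y\<in>ball x r. h y \<noteq> 0"
      using r by (intro densely_nonzero_onD[OF r(5), of _ x]) auto
    with r show "\<exists>U g h. open U \<and> connected U \<and> x \<in> U \<and> U \<subseteq> D \<and>
        mv_holomorphic_on g U \<and> mv_holomorphic_on h U \<and> (\<exists>y\<in>U. h y \<noteq> 0) \<and>
        (\<forall>y\<in>U. h y \<noteq> 0 \<longrightarrow> F y = g y / h y)"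
      by (intro exI[of _ "ball x r"] exI[of _ g] exI[of _ h]) auto
  qed
qed

lemma mv_meromorphic_onE:
  assumes "mv_meromorphic_on F D" "open D" "x \<in> D"
  obtains r g h where "r > 0" "ball x r \<subseteq> D"
    "mv_holomorphic_on g (ball x r)" "mv_holomorphic_on h (ball x r)" "densely_nonzero_on h (ball x r)"
    "\<forall>y\<in>ball x r. h y \<noteq> 0 \<longrightarrow> F y = g y / h y"
  using assms(1,3) unfolding mv_meromorphic_on_iff_ball[OF assms(2)] by meson

lemma mv_meromorphic_on_add:
  assumes F: "mv_meromorphic_on F D" and G: "mv_meromorphic_on G D" and D: "open D"
  shows "mv_meromorphic_on (\<lambda>x. F x + G x) D"
  unfolding mv_meromorphic_on_iff_ball[OF D]
proof
  fix x assume x: "x \<in> D"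
  obtain r g h where 1: "r > 0" "ball x r \<subseteq> D"
    "mv_holomorphic_on g (ball x r)" "mv_holomorphic_on h (ball x r)" "densely_nonzero_on h (ball x r)"
    "\<forall>y\<in>ball x r. h y \<noteq> 0 \<longrightarrow> F y = g y / h y"
    using mv_meromorphic_onE[OF F D x] .
  obtain s k l where 2: "s > 0" "ball x s \<subseteq> D"
    "mv_holomorphic_on k (ball x s)" "mv_holomorphic_on l (ball x s)" "densely_nonzero_on l (ball x s)"
    "\<forall>y\<in>ball x s. l y \<noteq> 0 \<longrightarrow> G y = k y / l y"
    using mv_meromorphic_onE[OF G D x] .
  let ?t = "min r s"
  have sub: "ball x ?t \<subseteq> ball x r" "ball x ?t \<subseteq> ball x s" by auto
  note hol = mv_holomorphic_on_subset[OF 1(3) sub(1)] mv_holomorphic_on_subset[OF 1(4) sub(1)]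
    mv_holomorphic_on_subset[OF 2(3) sub(2)] mv_holomorphic_on_subset[OF 2(4) sub(2)]
  have "densely_nonzero_on (\<lambda>y. h y * l y) (ball x ?t)"
    by (intro densely_nonzero_on_mult hol densely_nonzero_on_subset[OF 1(5) sub(1)]
        densely_nonzero_on_subset[OF 2(5) sub(2)])
  moreover have "\<forall>y\<in>ball x ?t. h y * l y \<noteq> 0 \<longrightarrow> F y + G y = (g y * l y + k y * h y) / (h y * l y)"
    using 1(6) 2(6) by (auto simp: field_simps)
  ultimately show "\<exists>r g h. r > 0 \<and> ball x r \<subseteq> D \<and>
      mv_holomorphic_on g (ball x r) \<and> mv_holomorphic_on h (ball x r) \<and> densely_nonzero_on h (ball x r) \<and>
      (\<forall>y\<in>ball x r. h y \<noteq> 0 \<longrightarrow> F y + G y = g y / h y)"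
    using 1 2 sub
    by (intro exI[of _ ?t] exI[of _ "\<lambda>y. g y * l y + k y * h y"] exI[of _ "\<lambda>y. h y * l y"] conjI
        mv_holomorphic_on_add mv_holomorphic_on_mult hol) auto
qed

lemma mv_meromorphic_on_mult_holomorphic:
  assumes c: "mv_holomorphic_on c D" and F: "mv_meromorphic_on F D" and D: "open D"
  shows "mv_meromorphic_on (\<lambda>x. c x * F x) D"
  unfolding mv_meromorphic_on_iff_ball[OF D]
proof
  fix x assume x: "x \<in> D"
  obtain r g h where 1: "r > 0" "ball x r \<subseteq> D"
    "mv_holomorphic_on g (ball x r)" "mv_holomorphic_on h (ball x r)" "densely_nonzero_on h (ball x r)"
    "\<forall>y\<in>ball x r. h y \<noteq> 0 \<longrightarrow> F y = g y / h y"
    using mv_meromorphic_onE[OF F D x] .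
  then show "\<exists>r g h. r > 0 \<and> ball x r \<subseteq> D \<and>
      mv_holomorphic_on g (ball x r) \<and> mv_holomorphic_on h (ball x r) \<and> densely_nonzero_on h (ball x r) \<and>
      (\<forall>y\<in>ball x r. h y \<noteq> 0 \<longrightarrow> c y * F y = g y / h y)"
    by (intro exI[of _ r] exI[of _ "\<lambda>y. c y * g y"] exI[of _ h] conjI
        mv_holomorphic_on_mult mv_holomorphic_on_subset[OF c]) auto
qed

lemma mv_meromorphic_on_const: "open D \<Longrightarrow> mv_meromorphic_on (\<lambda>x. c) D"
  unfolding mv_meromorphic_on_def
proof
  fix x assume "open D" "x \<in> D"
  then obtain r where "r > 0" "ball x r \<subseteq> D" by (meson openE)
  then show "\<exists>U g h. open U \<and> connected U \<and> x \<in> U \<and> U \<subseteq> D \<and> mv_holomorphic_on g U \<and>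
      mv_holomorphic_on h U \<and> (\<exists>y\<in>U. h y \<noteq> 0) \<and> (\<forall>y\<in>U. h y \<noteq> 0 \<longrightarrow> c = g y / h y)"
    by (intro exI[of _ "ball x r"] exI[of _ "\<lambda>x. c"] exI[of _ "\<lambda>x. 1"])
      (auto intro!: mv_holomorphic_on_const exI[of _ x])
qed

lemma mv_meromorphic_on_sum:
  assumes "open D" "\<And>i. i \<in> I \<Longrightarrow> mv_meromorphic_on (F i) D"
  shows "mv_meromorphic_on (\<lambda>x. \<Sum>i\<in>I. F i x) D"
  using assms(2)
  by (induction I rule: infinite_finite_induct)
    (auto intro!: mv_meromorphic_on_const mv_meromorphic_on_add assms(1))

lemma mv_meromorphic_on_linear_compose:
  assumes F: "mv_meromorphic_on F D" and D: "open D"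
    and T: "bounded_linear T" "\<And>c v. T (c *s v) = c *s T v" "\<And>x. x \<in> D \<Longrightarrow> T x \<in> D"
    and S: "continuous_on UNIV S" "\<And>x. S (T x) = x" "\<And>x. T (S x) = x"
  shows "mv_meromorphic_on (\<lambda>x. F (T x)) D"
  unfolding mv_meromorphic_on_iff_ball[OF D]
proof
  fix x assume x: "x \<in> D"
  obtain r g h where 1: "r > 0" "ball (T x) r \<subseteq> D"
    "mv_holomorphic_on g (ball (T x) r)" "mv_holomorphic_on h (ball (T x) r)"
    "densely_nonzero_on h (ball (T x) r)"
    "\<forall>y\<in>ball (T x) r. h y \<noteq> 0 \<longrightarrow> F y = g y / h y"
    using mv_meromorphic_onE[OF F D T(3)[OF x]] .
  have "open (T -` ball (T x) r \<inter> D)"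
    using D T(1) by (intro open_Int open_vimage linear_continuous_on) auto
  moreover have "x \<in> T -` ball (T x) r \<inter> D" using x 1 by simp
  ultimately obtain s where s: "s > 0" "ball x s \<subseteq> T -` ball (T x) r \<inter> D"
    by (meson openE)
  have Ts: "T y \<in> ball (T x) r" if "y \<in> ball x s" for y using s that by blast
  have "densely_nonzero_on (\<lambda>y. h (T y)) (ball x s)"
    unfolding densely_nonzero_on_def
  proof (intro allI impI)
    fix V :: "(complex^'a) set" assume V: "open V" "V \<noteq> {}" "V \<subseteq> ball x s"
    then obtain v where v: "v \<in> V" by blast
    have "\<exists>z\<in>S -` V. h z \<noteq> 0"
    proof (rule densely_nonzero_onD[OF 1(5), of _ "T v"])
      show "open (S -` V)" using S V by (intro open_vimage)
      show "S -` V \<subseteq> ball (T x) r"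
        using V(3) Ts S(3) by (metis subset_iff vimageE)
    qed (use v S in simp)
    then show "\<exists>y\<in>V. h (T y) \<noteq> 0" using S by (metis vimageE)
  qed
  then show "\<exists>r g h. r > 0 \<and> ball x r \<subseteq> D \<and>
      mv_holomorphic_on g (ball x r) \<and> mv_holomorphic_on h (ball x r) \<and> densely_nonzero_on h (ball x r) \<and>
      (\<forall>y\<in>ball x r. h y \<noteq> 0 \<longrightarrow> F (T y) = g y / h y)"
    using s Ts 1
    by (intro exI[of _ s] exI[of _ "\<lambda>y. g (T y)"] exI[of _ "\<lambda>y. h (T y)"] conjI
        mv_holomorphic_on_linear_compose[OF 1(3) T(1,2)] mv_holomorphic_on_linear_compose[OF 1(4) T(1,2)]) auto
qed

text \<open>Continuity at \<open>x\<close> is needed since the values of \<open>F\<close> on the zero sets of the local denominators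
  are arbitrary. For the same reason the connectedness argument runs on the interior of the closure
  of \<open>E\<close> rather than on \<open>E\<close>.\<close>

lemma mv_meromorphic_eq_0:
  fixes F :: "complex^'n \<Rightarrow> complex"
  assumes F: "mv_meromorphic_on F D" and D: "open D" "connected D"
    and V: "open V" "V \<noteq> {}" "V \<subseteq> D" "\<And>z. z \<in> V \<Longrightarrow> F z = 0"
    and x: "x \<in> D" "isCont F x"
  shows "F x = 0"
proof -
  define E where "E = interior {z \<in> D. F z = 0}"
  have E: "open E" "\<And>z. z \<in> E \<Longrightarrow> F z = 0"
    unfolding E_def using interior_subset by auto
  have "V \<subseteq> E" unfolding E_def using V by (intro interior_maximal) auto
  have cl: "z \<in> interior (closure E)" if z: "z \<in> D" "z \<in> closure E" for z
  proof -
    obtain r g h where 1: "r > 0" "ball z r \<subseteq> D"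
      "mv_holomorphic_on g (ball z r)" "mv_holomorphic_on h (ball z r)" "densely_nonzero_on h (ball z r)"
      "\<forall>y\<in>ball z r. h y \<noteq> 0 \<longrightarrow> F y = g y / h y"
      using mv_meromorphic_onE[OF F D(1) z(1)] .
    obtain y where y: "y \<in> E" "y \<in> ball z r"
      using z(2) 1(1) by (auto simp: closure_approachable dist_commute)
    have g0: "g w = 0" if w: "w \<in> E \<inter> ball z r" for w
    proof (rule ccontr)
      assume "g w \<noteq> 0"
      then have "\<exists>v\<in>{v \<in> E \<inter> ball z r. g v \<noteq> 0}. h v \<noteq> 0"
        using w E(1)
        by (intro densely_nonzero_onD[OF 1(5), of _ w] mv_holomorphic_nonzero_open[OF 1(3)]) auto
      then show False using E(2) 1(6) by fastforce
    qed
    have g: "g w = 0" if "w \<in> ball z r" for w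
      by (rule mv_identity_theorem[OF 1(3), of "E \<inter> ball z r"]) (use E(1) y g0 that in auto)
    have "{w \<in> ball z r. h w \<noteq> 0} \<subseteq> E"
      unfolding E_def using 1(2,6) g
      by (intro interior_maximal mv_holomorphic_nonzero_open[OF 1(4)]) auto
    moreover have "ball z r \<subseteq> closure {w \<in> ball z r. h w \<noteq> 0}"
    proof
      fix w assume w: "w \<in> ball z r"
      show "w \<in> closure {w \<in> ball z r. h w \<noteq> 0}"
        unfolding closure_iff_nhds_not_empty
      proof (intro allI impI)
        fix A T assume "T \<subseteq> A" "w \<in> T" "open T"
        then have "\<exists>v\<in>T \<inter> ball z r. h v \<noteq> 0"
          using w by (intro densely_nonzero_onD[OF 1(5), of _ w]) auto
        then show "{w \<in> ball z r. h w \<noteq> 0} \<inter> A \<noteq> {}" using \<open>T \<subseteq> A\<close> by blast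
      qed
    qed
    ultimately have "ball z r \<subseteq> closure E" using closure_mono by blast
    then have "ball z r \<subseteq> interior (closure E)" by (intro interior_maximal) auto
    then show ?thesis using 1(1) by auto
  qed
  have "interior (closure E) \<inter> D = {} \<or> - closure E \<inter> D = {}"
    using cl interior_subset[of "closure E"] by (intro connectedD[OF D(2)]) auto
  moreover have "V \<subseteq> interior (closure E)"
    using \<open>V \<subseteq> E\<close> closure_subset[of E] V(1) by (intro interior_maximal) auto
  then have "interior (closure E) \<inter> D \<noteq> {}" using V by blast
  ultimately have xE: "x \<in> closure E" using x by blast
  show ?thesis
  proof (rule ccontr)
    assume "F x \<noteq> 0"
    then obtain e where e: "e > 0" "\<And>y. dist x y < e \<Longrightarrow> F y \<noteq> 0"
      using continuous_at_avoid[OF x(2)] by blast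
    obtain y where "y \<in> E" "dist y x < e" using xE e(1) by (auto simp: closure_approachable)
    then show False using e(2)[of y] E(2)[of y] by (simp add: dist_commute)
  qed
qed

section \<open>The parameter domains and the shift of one parameter\<close>

lemma open_cstar8: "open cstar8"
proof -
  have eq: "cstar8 = (\<Inter>r. (\<lambda>ts. ts $ r) -` (- {0}))" by (auto simp: cstar8_def)
  have "open ((\<lambda>ts::complex^8. ts $ r) -` (- {0}))" for r
    by (intro open_vimage) (auto intro!: continuous_intros)
  then show ?thesis unfolding eq by (intro open_INT) auto
qed

lemma connected_cstar8: "connected cstar8"
proof -
  have "ts \<in> range (\<lambda>v::complex^8. \<chi> r. exp (v $ r))" if "ts \<in> cstar8" for ts
    using that by (intro image_eqI[of _ _ "\<chi> r. Ln (ts $ r)"]) (auto simp: cstar8_def vec_eq_iff)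
  then have eq: "cstar8 = range (\<lambda>v::complex^8. \<chi> r. exp (v $ r))"
    by (auto simp: cstar8_def)
  show ?thesis unfolding eq
    by (intro connected_continuous_image) (auto intro!: continuous_intros)
qed

lemma open_punctured_polydisc8: "open punctured_polydisc8"
proof -
  have eq: "punctured_polydisc8 = (\<Inter>r. (\<lambda>ts. ts $ r) -` (ball 0 1 - {0}))"
    by (auto simp: punctured_polydisc8_def)
  have "open ((\<lambda>ts::complex^8. ts $ r) -` (ball 0 1 - {0}))" for r
    by (intro open_vimage) (auto intro!: continuous_intros)
  then show ?thesis unfolding eq by (intro open_INT) auto
qed

lemma punctured_polydisc8_nonempty: "punctured_polydisc8 \<noteq> {}"
proof -
  have "(\<chi> r. 1 / 2) \<in> punctured_polydisc8" by (auto simp: punctured_polydisc8_def)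
  then show ?thesis by blast
qed

lemma punctured_polydisc8_subset: "punctured_polydisc8 \<subseteq> cstar8"
  by (auto simp: punctured_polydisc8_def cstar8_def)

lemma q_shift_linear:
  shows "bounded_linear (q_shift q i)" "q_shift q i (c *s v) = c *s q_shift q i v"
proof -
  have "linear (q_shift q i)"
    by (rule linearI) (auto simp: q_shift_def vec_eq_iff algebra_simps)
  then show "bounded_linear (q_shift q i)" by (simp add: linear_conv_bounded_linear)
qed (auto simp: q_shift_def vec_eq_iff)

lemma q_shift_inverse: "q \<noteq> 0 \<Longrightarrow> q_shift (1 / q) i (q_shift q i v) = v"
  by (auto simp: q_shift_def vec_eq_iff)

lemma q_shift_cstar8: "q \<noteq> 0 \<Longrightarrow> q_shift q i ts \<in> cstar8 \<longleftrightarrow> ts \<in> cstar8"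
  by (auto simp: q_shift_def cstar8_def)

lemma mv_meromorphic_on_q_shift:
  assumes "mv_meromorphic_on F cstar8" "q \<noteq> 0"
  shows "mv_meromorphic_on (\<lambda>s. F (q_shift q i s)) cstar8"
  by (rule mv_meromorphic_on_linear_compose[where S = "q_shift (1 / q) i"])
    (use assms q_shift_inverse[of "1/q"] in \<open>auto simp: open_cstar8 q_shift_linear q_shift_cstar8
       q_shift_inverse linear_continuous_on\<close>)

section \<open>The integrals over the torus\<close>

text \<open>Collects what dominated convergence asks of an integrand with parameter
  \<open>s\<close>, with a constant as majorant. It is closed under products, so the factors of the
  integrand can be treated one at a time.\<close>

definition bounded_family :: "'s::topological_space set \<Rightarrow> 'x measure \<Rightarrow> ('s \<Rightarrow> 'x \<Rightarrow> complex) \<Rightarrow> bool" where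
  "bounded_family V M f \<longleftrightarrow>
     (\<forall>s\<in>V. f s \<in> borel_measurable M) \<and>
     (\<forall>x\<in>space M. continuous_on V (\<lambda>s. f s x)) \<and>
     (\<exists>B. \<forall>s\<in>V. \<forall>x\<in>space M. norm (f s x) \<le> B)"

lemma bounded_family_const:
  "(\<lambda>x. c) \<in> borel_measurable M \<Longrightarrow> bounded_family V M (\<lambda>s x. c)"
  unfolding bounded_family_def by auto

lemma bounded_family_mult:
  assumes "bounded_family V M f" "bounded_family V M g"
  shows "bounded_family V M (\<lambda>s x. f s x * g s x)"
proof -
  obtain A where A: "\<And>s x. s \<in> V \<Longrightarrow> x \<in> space M \<Longrightarrow> norm (f s x) \<le> A"
    using assms(1) unfolding bounded_family_def by blast
  obtain B where B: "\<And>s x. s \<in> V \<Longrightarrow> x \<in> space M \<Longrightarrow> norm (g s x) \<le> B"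
    using assms(2) unfolding bounded_family_def by blast
  have "norm (f s x * g s x) \<le> A * B" if "s \<in> V" "x \<in> space M" for s x
    using A[OF that] B[OF that] order_trans[OF norm_ge_zero A[OF that]] unfolding norm_mult
    by (intro mult_mono) auto
  then show ?thesis
    using assms unfolding bounded_family_def
    by (auto intro!: continuous_intros borel_measurable_times)
qed

lemma bounded_family_prod:
  assumes "\<And>i. i \<in> I \<Longrightarrow> bounded_family V M (f i)"
  shows "bounded_family V M (\<lambda>s x. \<Prod>i\<in>I. f i s x)"
  using assms
  by (induction I rule: infinite_finite_induct) (auto intro!: bounded_family_const bounded_family_mult)

text \<open>\<open>G\<close> is continuous only on \<open>K\<close>, as \<open>ell_gamma\<close> is
  away from its poles. Compactness gives the uniform bound, and measurability is obtained for
  \<open>G\<close> restricted to \<open>K\<close>.\<close>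

lemma bounded_family_compose:
  assumes G: "continuous_on K G" and K: "compact K"
    and u: "\<And>s. s \<in> V \<Longrightarrow> u s \<in> borel_measurable M"
      "\<And>x. x \<in> space M \<Longrightarrow> continuous_on V (\<lambda>s. u s x)"
      "\<And>s x. s \<in> V \<Longrightarrow> x \<in> space M \<Longrightarrow> u s x \<in> K"
  shows "bounded_family V M (\<lambda>s x. G (u s x :: complex))"
proof -
  have "compact (G ` K)" by (rule compact_continuous_image[OF G K])
  then obtain B where B: "\<And>y. y \<in> K \<Longrightarrow> norm (G y) \<le> B"
    by (meson bounded_iff compact_imp_bounded image_eqI)
  have "(\<lambda>x. G (u s x)) \<in> borel_measurable M" if s: "s \<in> V" for s
  proof (rule measurable_compose[where f = "u s" and g = G])
    show "u s \<in> measurable M (restrict_space borel K)"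
      using u(1,3) s by (intro measurable_restrict_space2) auto
    show "G \<in> borel_measurable (restrict_space borel K)"
      by (rule borel_measurable_continuous_on_restrict[OF G])
  qed
  moreover have "continuous_on V (\<lambda>s. G (u s x))" if "x \<in> space M" for x
    by (rule continuous_on_compose2[OF G u(2)[OF that]]) (use u(3) that in auto)
  ultimately show ?thesis
    using B u(3) unfolding bounded_family_def by blast
qed

lemma bounded_family_integrable:
  assumes "finite_measure M" "bounded_family V M f" "s \<in> V"
  shows "integrable M (f s)"
proof -
  interpret finite_measure M by fact
  obtain B where B: "\<And>s x. s \<in> V \<Longrightarrow> x \<in> space M \<Longrightarrow> norm (f s x) \<le> B"
    using assms(2) unfolding bounded_family_def by blast
  show ?thesis
    by (rule integrable_const_bound[of _ B])
      (use assms B in \<open>auto simp: bounded_family_def\<close>)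
qed

lemma bounded_family_integral_continuous:
  fixes f :: "'s::metric_space \<Rightarrow> 'x \<Rightarrow> complex"
  assumes "finite_measure M" "bounded_family V M f"
  shows "continuous_on V (\<lambda>s. LINT x|M. f s x)"
  unfolding continuous_on_sequentially
proof (intro allI ballI impI, elim conjE)
  interpret finite_measure M by fact
  fix X :: "nat \<Rightarrow> 's" and a :: 's
  assume a: "a \<in> V" and X: "\<forall>n. X n \<in> V" "X \<longlonglongrightarrow> a"
  obtain B where B: "\<And>s x. s \<in> V \<Longrightarrow> x \<in> space M \<Longrightarrow> norm (f s x) \<le> B"
    using assms(2) unfolding bounded_family_def by blast
  show "((\<lambda>s. LINT x|M. f s x) \<circ> X) \<longlonglongrightarrow> (LINT x|M. f a x)"
    unfolding o_def
  proof (rule integral_dominated_convergence)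
    show "f a \<in> borel_measurable M" "\<And>n. f (X n) \<in> borel_measurable M"
      using assms(2) a X unfolding bounded_family_def by auto
    show "integrable M (\<lambda>x. B)" by simp
    show "AE x in M. (\<lambda>n. f (X n) x) \<longlonglongrightarrow> f a x"
    proof (rule AE_I2)
      fix x assume "x \<in> space M"
      then have "continuous_on V (\<lambda>s. f s x)" using assms(2) unfolding bounded_family_def by blast
      then show "(\<lambda>n. f (X n) x) \<longlonglongrightarrow> f a x"
        using a X unfolding continuous_on_sequentially o_def by blast
    qed
    show "\<And>n. AE x in M. norm (f (X n) x) \<le> B" using B X by auto
  qed
qed

section \<open>The torus integral and its dependence on the parameters\<close>

abbreviation torus_measure :: "nat \<Rightarrow> (nat \<Rightarrow> real) measure" where
  "torus_measure n \<equiv> (\<Pi>\<^sub>M i\<in>{1..n}. restrict_space lborel {0..1})"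

lemma finite_measure_torus: "finite_measure (torus_measure n)"
proof -
  have "prob_space (torus_measure n)"
    by (intro prob_space_PiM prob_space_restrict_space) auto
  then show ?thesis by (rule prob_space.finite_measure)
qed

abbreviation circle_pt :: "(nat \<Rightarrow> real) \<Rightarrow> nat \<Rightarrow> complex" where
  "circle_pt x i \<equiv> circlepath 0 1 (x i)"

lemma norm_circle_pt: "norm (circlepath 0 1 t :: complex) = 1"
  by (simp add: circlepath)

lemma measurable_torus_component:
  assumes "i \<in> {1..n}" shows "(\<lambda>x. x i) \<in> borel_measurable (torus_measure n)"
proof -
  have "(\<lambda>x. x i) \<in> measurable (torus_measure n) (restrict_space lborel {0..1::real})"
    using assms by (rule measurable_component_singleton)
  then have "(\<lambda>x. x i) \<in> measurable (torus_measure n) lborel"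
    by (rule measurable_restrict_space2_iff[THEN iffD1, THEN conjunct1])
  then show ?thesis by simp
qed

lemma measurable_circle_pt:
  assumes "i \<in> {1..n}" shows "(\<lambda>x. circle_pt x i) \<in> borel_measurable (torus_measure n)"
proof -
  have "circlepath 0 1 \<in> borel_measurable borel"
    unfolding circlepath by (intro borel_measurable_continuous_onI continuous_intros)
  from measurable_compose[OF measurable_torus_component[OF assms] this] show ?thesis .
qed

lemma measurable_circle_deriv:
  assumes "i \<in> {1..n}"
  shows "(\<lambda>x. vector_derivative (circlepath 0 1) (at (x i)) :: complex) \<in> borel_measurable (torus_measure n)"
proof -
  have "(\<lambda>t. vector_derivative (circlepath 0 1) (at t)  :: complex) \<in> borel_measurable borel"
    unfolding vector_derivative_circlepath by (intro borel_measurable_continuous_onI continuous_intros)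
  from measurable_compose[OF measurable_torus_component[OF assms] this] show ?thesis .
qed

lemma bounded_family_circle_deriv:
  assumes "i \<in> {1..n}"
  shows "bounded_family V (torus_measure n) (\<lambda>s x. vector_derivative (circlepath 0 1) (at (x i)) :: complex)"
proof -
  have "norm (vector_derivative (circlepath 0 1) (at t) :: complex) \<le> 2 * pi" for t
    unfolding vector_derivative_circlepath by (simp add: norm_mult)
  then show ?thesis
    unfolding bounded_family_def using measurable_circle_deriv[OF assms] by auto
qed

text \<open>The annulus is compact and avoids 0 and all poles of \<open>ell_gamma p q\<close>, which
  have modulus at least 1.\<close>

lemma bounded_family_ell_gamma:
  assumes pq: "norm p < 1" "norm q < 1" and ab: "0 < a" "b < 1"
    and u: "\<And>s. s \<in> V \<Longrightarrow> u s \<in> borel_measurable M"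
      "\<And>x. x \<in> space M \<Longrightarrow> continuous_on V (\<lambda>s. u s x)"
      "\<And>s x. s \<in> V \<Longrightarrow> x \<in> space M \<Longrightarrow> a \<le> norm (u s x) \<and> norm (u s x) \<le> b"
  shows "bounded_family V M (\<lambda>s x. ell_gamma p q (u s x))"
proof (rule bounded_family_compose[where G = "ell_gamma p q" and u = u])
  show "continuous_on (cball 0 b - ball 0 a) (ell_gamma p q)"
    by (rule continuous_on_subset[OF continuous_on_ell_gamma[OF pq]]) (use ab in auto)
  show "compact (cball 0 b - ball 0 a :: complex set)" by (intro compact_diff) auto
qed (use u in \<open>simp_all add: not_less\<close>)

lemma bounded_family_inverse_ell_gamma:
  assumes pq: "norm p < 1" "norm q < 1"
    and u: "u \<in> borel_measurable M" "\<And>x. x \<in> space M \<Longrightarrow> norm (u x) = 1"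
  shows "bounded_family V M (\<lambda>s x. 1 / ell_gamma p q (u x))"
  by (rule bounded_family_compose[OF continuous_on_inverse_ell_gamma[OF pq]])
    (use u in auto)

text \<open>Three kinds of gamma factor occur: arguments of modulus \<open>norm t\<close>
  (\<open>T\<close>), reciprocals at arguments of modulus 1 (\<open>N\<close>), and
  \<open>s $ r\<close> times a point of the circle (\<open>R\<close>). The bounds \<open>a\<close>
  and \<open>b\<close> keep the last kind in one annulus for all \<open>s\<close> in
  \<open>V\<close>.\<close>

lemma bounded_family_II_integrand:
  fixes V :: "(complex^8) set"
  assumes pqt: "norm p < 1" "norm q < 1" "norm t < 1" "t \<noteq> 0" and ab: "0 < a" "b < 1"
    and V: "\<And>s r. s \<in> V \<Longrightarrow> a \<le> norm (s $ r) \<and> norm (s $ r) \<le> b"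
  shows "bounded_family V (torus_measure n) (\<lambda>s x. II_integrand n t p q s (circle_pt x) *
     (\<Prod>i\<in>{1..n}. vector_derivative (circlepath 0 1) (at (x i))))"
proof -
  let ?M = "torus_measure n"
  let ?g = "ell_gamma p q"
  note meas = measurable_circle_pt
  have T: "bounded_family V ?M (\<lambda>s x. ?g (u x))"
    if "u \<in> borel_measurable ?M" "\<And>x. norm (u x) = norm t" for u
    by (rule bounded_family_ell_gamma[of _ _ "norm t" "norm t"]) (use pqt that in auto)
  have N: "bounded_family V ?M (\<lambda>s x. 1 / ?g (u x))"
    if "u \<in> borel_measurable ?M" "\<And>x. norm (u x) = 1" for u
    by (rule bounded_family_inverse_ell_gamma) (use pqt that in auto)
  have R: "bounded_family V ?M (\<lambda>s x. ?g (s $ r * u x))"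
    if "u \<in> borel_measurable ?M" "\<And>x. norm (u x) = 1" for u r
    by (rule bounded_family_ell_gamma[OF pqt(1,2) ab])
      (use that V in \<open>auto simp: norm_mult intro!: continuous_intros borel_measurable_times\<close>)
  note n = norm_mult norm_divide norm_power norm_circle_pt
  have 1: "bounded_family V ?M (\<lambda>s x.
        (?g (t * circle_pt x i * circle_pt x j) * ?g (t * circle_pt x i / circle_pt x j) *
         ?g (t * circle_pt x j / circle_pt x i) * ?g (t / (circle_pt x i * circle_pt x j))) *
        ((1 / ?g (circle_pt x i * circle_pt x j)) * (1 / ?g (circle_pt x i / circle_pt x j)) *
         (1 / ?g (circle_pt x j / circle_pt x i)) * (1 / ?g (1 / (circle_pt x i * circle_pt x j)))))"
    if "i \<in> {1..n}" "j \<in> {1..n}" for i j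
    by (intro bounded_family_mult T N borel_measurable_times borel_measurable_divide meas that borel_measurable_const)
      (simp_all add: n)
  have 2: "bounded_family V ?M (\<lambda>s x.
        (\<Prod>r\<in>UNIV. ?g (s $ r * circle_pt x i) * ?g (s $ r * (1 / circle_pt x i))) *
        ((1 / ?g (circle_pt x i ^ 2)) * (1 / ?g (1 / circle_pt x i ^ 2))) *
        (1 / (2 * of_real pi * \<i> * circle_pt x i)))"
    if "i \<in> {1..n}" for i
  proof -
    have "bounded_family V ?M (\<lambda>s x. 1 / (2 * of_real pi * \<i> * circle_pt x i))"
      by (rule bounded_family_compose[where K = "sphere 0 1" and G = "\<lambda>y. 1 / (2 * of_real pi * \<i> * y)"])
        (use meas[OF that] norm_circle_pt in \<open>auto intro!: continuous_intros\<close>)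
    then show ?thesis
      by (intro bounded_family_mult bounded_family_prod R N borel_measurable_times borel_measurable_divide
           borel_measurable_power meas that borel_measurable_const)
        (simp_all add: n)
  qed
  have "bounded_family V ?M (\<lambda>s x.
     ((\<Prod>j\<in>{1..n}. \<Prod>i\<in>{1..<j}.
        (?g (t * circle_pt x i * circle_pt x j) * ?g (t * circle_pt x i / circle_pt x j) *
         ?g (t * circle_pt x j / circle_pt x i) * ?g (t / (circle_pt x i * circle_pt x j))) *
        ((1 / ?g (circle_pt x i * circle_pt x j)) * (1 / ?g (circle_pt x i / circle_pt x j)) *
         (1 / ?g (circle_pt x j / circle_pt x i)) * (1 / ?g (1 / (circle_pt x i * circle_pt x j))))) *
     (\<Prod>i\<in>{1..n}. (\<Prod>r\<in>UNIV. ?g (s $ r * circle_pt x i) * ?g (s $ r * (1 / circle_pt x i))) *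
        ((1 / ?g (circle_pt x i ^ 2)) * (1 / ?g (1 / circle_pt x i ^ 2))) *
        (1 / (2 * of_real pi * \<i> * circle_pt x i)))) *
     (\<Prod>i\<in>{1..n}. vector_derivative (circlepath 0 1) (at (x i))))"
    by (intro bounded_family_mult[of V ?M "\<lambda>s x. _ s x * _ s x"] bounded_family_mult bounded_family_prod bounded_family_circle_deriv 1 2) auto
  \<comment> \<open>On the unit circle only \<open>1 / ell_gamma\<close> is under control, so
    quotients are read as products of reciprocals. With \<open>x / 0 = 0\<close> this is exact also
    where \<open>ell_gamma\<close> takes the junk value 0.\<close>
  moreover have "A / (?g a * ?g b * ?g c * ?g d) = A * ((1 / ?g a) * (1 / ?g b) * (1 / ?g c) * (1 / ?g d))"
    "A / (?g a * ?g b) = A * ((1 / ?g a) * (1 / ?g b))"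
    "?g (s $ r / y) = ?g (s $ r * (1 / y))" for A a b c d y r and s :: "complex^8"
    by simp_all
  ultimately show ?thesis
    unfolding II_integrand_def by (simp only:)
qed

lemma II_unit_circle_eq:
  "II_unit_circle n t p q s = euler_prod p ^ n * euler_prod q ^ n / (2 ^ n * fact n) *
     (LINT x | torus_measure n. II_integrand n t p q s (circle_pt x) *
        (\<Prod>i\<in>{1..n}. vector_derivative (circlepath 0 1) (at (x i))))"
  unfolding II_unit_circle_def torus_integral_def ..

lemma II_integrable:
  assumes "norm p < 1" "norm q < 1" "norm t < 1" "t \<noteq> 0" and s: "s \<in> punctured_polydisc8"
  shows "integrable (torus_measure n) (\<lambda>x. II_integrand n t p q s (circle_pt x) *
     (\<Prod>i\<in>{1..n}. vector_derivative (circlepath 0 1) (at (x i))))"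
proof (rule bounded_family_integrable[OF finite_measure_torus, where V = "{s}" and s = s])
  let ?N = "range (\<lambda>r. norm (s $ r))"
  have N: "finite ?N" "?N \<noteq> {}" by auto
  show "bounded_family {s} (torus_measure n) (\<lambda>s x. II_integrand n t p q s (circle_pt x) *
     (\<Prod>i\<in>{1..n}. vector_derivative (circlepath 0 1) (at (x i))))"
    by (rule bounded_family_II_integrand[OF assms(1-4), of "Min ?N" "Max ?N"])
      (use s N in \<open>auto simp: punctured_polydisc8_def\<close>)
qed auto

text \<open>Serves shifted parameters that lie inside the polydisc although the unshifted ones do
  not: near such a point a continuation agrees with this integral.\<close>

lemma II_unit_circle_isCont:
  assumes "norm p < 1" "norm q < 1" "norm t < 1" "t \<noteq> 0" and s: "s \<in> punctured_polydisc8"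
  shows "isCont (II_unit_circle n t p q) s"
proof -
  let ?N = "range (\<lambda>r. norm (s $ r))"
  define m where "m = Min ?N"
  define M where "M = Max ?N"
  have N: "finite ?N" "?N \<noteq> {}" by auto
  have mM: "0 < m" "M < 1" "\<And>r. m \<le> norm (s $ r)" "\<And>r. norm (s $ r) \<le> M"
    unfolding m_def M_def using s N by (auto simp: punctured_polydisc8_def)
  \<comment> \<open>Half the gap to 0 and to 1: points of the ball keep all moduli between
    \<open>m - e > 0\<close> and \<open>M + e < 1\<close>.\<close>
  define e where "e = min (m / 2) ((1 - M) / 2)"
  have e: "e > 0" "m - e > 0" "M + e < 1" using mM(1,2) by (auto simp: e_def min_def field_simps)
  have "m - e \<le> norm (y $ r) \<and> norm (y $ r) \<le> M + e" if "y \<in> ball s e" for y :: "complex^8" and r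
  proof -
    have "norm (s $ r - y $ r) \<le> e"
      using that Finite_Cartesian_Product.norm_nth_le[of "s - y" r] by (simp add: dist_norm)
    then show ?thesis
      using mM(3)[of r] mM(4)[of r] norm_triangle_ineq3[of "s $ r" "y $ r"] by linarith
  qed
  then have "bounded_family (ball s e) (torus_measure n) (\<lambda>s x. II_integrand n t p q s (circle_pt x) *
     (\<Prod>i\<in>{1..n}. vector_derivative (circlepath 0 1) (at (x i))))"
    by (intro bounded_family_II_integrand[OF assms(1-4) e(2,3)])
  from bounded_family_integral_continuous[OF finite_measure_torus this]
  have "continuous_on (ball s e) (II_unit_circle n t p q)"
    unfolding II_unit_circle_eq by (intro continuous_intros)
  then show ?thesis using e(1) by (simp add: continuous_on_eq_continuous_at)
qed

lemma q_shift_punctured_polydisc8: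
  assumes "norm q < 1" "q \<noteq> 0" "s \<in> punctured_polydisc8"
  shows "q_shift q i s \<in> punctured_polydisc8"
proof -
  have "norm (q * s $ r) < 1" for r
    using norm_power_mult_less_1[OF assms(1), of "s $ r" 1] assms(3) by (simp add: punctured_polydisc8_def)
  then show ?thesis using assms by (auto simp: punctured_polydisc8_def q_shift_def)
qed

text \<open>Only the factors with \<open>r = of_nat i\<close> change. On the torus their arguments
  have the modulus of \<open>s $ of_nat i\<close>, below 1, so \<open>ell_gamma_shift\<close>
  applies.\<close>

lemma II_integrand_q_shift:
  assumes pq: "norm p < 1" "norm q < 1" "q \<noteq> 0" and s: "s \<in> punctured_polydisc8"
    and z: "\<And>k. k \<in> {1..n} \<Longrightarrow> norm (z k) = 1"
  shows "II_integrand n t p q (q_shift q i s) z =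
    (\<Prod>k\<in>{1..n}. theta p (s $ of_nat i * z k) * theta p (s $ of_nat i / z k)) * II_integrand n t p q s z"
proof -
  let ?g = "ell_gamma p q" and ?s' = "q_shift q i s"
  have *: "(\<Prod>r\<in>UNIV. ?g (?s' $ r * z k) * ?g (?s' $ r / z k)) =
    (theta p (s $ of_nat i * z k) * theta p (s $ of_nat i / z k)) *
      (\<Prod>r\<in>UNIV. ?g (s $ r * z k) * ?g (s $ r / z k))" if k: "k \<in> {1..n}" for k
  proof -
    let ?a = "of_nat i :: 8"
    have "s $ ?a \<noteq> 0" "norm (s $ ?a) < 1" using s by (auto simp: punctured_polydisc8_def)
    then have "?g (q * (s $ ?a * z k)) = theta p (s $ ?a * z k) * ?g (s $ ?a * z k)"
      "?g (q * (s $ ?a / z k)) = theta p (s $ ?a / z k) * ?g (s $ ?a / z k)"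
      using z[OF k] pq by (intro ell_gamma_shift; force simp: norm_mult norm_divide)+
    then have "?g (?s' $ ?a * z k) * ?g (?s' $ ?a / z k) =
      (theta p (s $ ?a * z k) * theta p (s $ ?a / z k)) * (?g (s $ ?a * z k) * ?g (s $ ?a / z k))"
      by (simp add: q_shift_def mult_ac)
    moreover have "(\<Prod>r\<in>UNIV - {?a}. ?g (?s' $ r * z k) * ?g (?s' $ r / z k)) =
        (\<Prod>r\<in>UNIV - {?a}. ?g (s $ r * z k) * ?g (s $ r / z k))"
      by (intro prod.cong) (auto simp: q_shift_def)
    ultimately show ?thesis
      by (simp only: prod.remove[OF finite, of ?a] UNIV_I mult.assoc)
  qed
  have "(\<Prod>k\<in>{1..n}. (\<Prod>r\<in>UNIV. ?g (?s' $ r * z k) * ?g (?s' $ r / z k)) /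
        (?g (z k ^ 2) * ?g (1 / z k ^ 2)) * (1 / (2 * of_real pi * \<i> * z k))) =
     (\<Prod>k\<in>{1..n}. (theta p (s $ of_nat i * z k) * theta p (s $ of_nat i / z k)) *
      ((\<Prod>r\<in>UNIV. ?g (s $ r * z k) * ?g (s $ r / z k)) /
        (?g (z k ^ 2) * ?g (1 / z k ^ 2)) * (1 / (2 * of_real pi * \<i> * z k))))"
    by (intro prod.cong refl) (simp only: * mult.assoc times_divide_eq_right[symmetric])
  also have "\<dots> = (\<Prod>k\<in>{1..n}. theta p (s $ of_nat i * z k) * theta p (s $ of_nat i / z k)) *
     (\<Prod>k\<in>{1..n}. (\<Prod>r\<in>UNIV. ?g (s $ r * z k) * ?g (s $ r / z k)) /
        (?g (z k ^ 2) * ?g (1 / z k ^ 2)) * (1 / (2 * of_real pi * \<i> * z k)))"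
    by (rule prod.distrib)
  finally show ?thesis
    unfolding II_integrand_def by (simp only: mult.left_commute)
qed

lemma II_unit_circle_q_shift_sum:
  fixes s :: "complex^8"
  assumes pqt: "norm p < 1" "norm q < 1" "norm t < 1" "q \<noteq> 0" "t \<noteq> 0"
    and s: "s \<in> punctured_polydisc8"
    and nz: "\<And>i. i \<in> {0..n + 1} \<Longrightarrow>
      (\<Prod>j\<in>{0..n + 1} - {i}. theta p (s $ of_nat i * s $ of_nat j) * theta p (s $ of_nat i / s $ of_nat j)) \<noteq> 0"
  shows "(\<Sum>i\<in>{0..n + 1}. s $ of_nat i * II_unit_circle n t p q (q_shift q i s) /
     (\<Prod>j\<in>{0..n + 1} - {i}. theta p (s $ of_nat i * s $ of_nat j) * theta p (s $ of_nat i / s $ of_nat j))) = 0"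
proof -
  let ?T = "{0..n + 1}"
  define A where "A i = (\<Prod>j\<in>?T - {i}. theta p (s $ of_nat i * s $ of_nat j) * theta p (s $ of_nat i / s $ of_nat j))" for i
  define \<Theta> where "\<Theta> i x = (\<Prod>k\<in>{1..n}. theta p (s $ of_nat i * circle_pt x k) * theta p (s $ of_nat i / circle_pt x k))" for i x
  define I where "I s x = II_integrand n t p q s (circle_pt x) *
     (\<Prod>i\<in>{1..n}. vector_derivative (circlepath 0 1) (at (x i)))" for s x
  define c where "c = euler_prod p ^ n * euler_prod q ^ n / (2 ^ n * fact n)"
  have I_shift: "I (q_shift q i s) x = \<Theta> i x * I s x" for i x
    unfolding I_def \<Theta>_def
    by (subst II_integrand_q_shift[OF pqt(1,2,4) s]) (simp_all add: norm_circle_pt mult.assoc)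
  \<comment> \<open>This is the integrand at the shifted parameters, which stay in the polydisc
    because \<open>norm q < 1\<close>.\<close>
  have int: "integrable (torus_measure n) (\<lambda>x. \<Theta> i x * I s x)" for i
    using II_integrable[OF pqt(1-3,5) q_shift_punctured_polydisc8[OF pqt(2,4) s], of n i]
    by (simp only: I_def[symmetric] I_shift)
  have s0: "s $ r \<noteq> 0" for r using s by (simp add: punctured_polydisc8_def)
  have id0: "(\<Sum>i\<in>?T. s $ of_nat i / A i * \<Theta> i x) = 0" for x
  proof -
    have "(\<Sum>i\<in>?T. s $ of_nat i * \<Theta> i x / A i) = 0"
      unfolding A_def \<Theta>_def
    proof (rule theta_partial_fraction_identity[OF pqt(1)])
      show "theta p (s $ of_nat i * s $ of_nat j) * theta p (s $ of_nat i / s $ of_nat j) \<noteq> 0"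
        if "i \<in> ?T" "j \<in> ?T" "i \<noteq> j" for i j
        using nz[OF that(1)] that by (auto simp: prod_zero_iff)
      show "circle_pt x k \<noteq> 0" for k using norm_circle_pt[of "x k"] by force
    qed (use s0 in auto)
    then show ?thesis by simp
  qed
  have "(\<Sum>i\<in>?T. s $ of_nat i * II_unit_circle n t p q (q_shift q i s) / A i) =
    (\<Sum>i\<in>?T. c * (LINT x|torus_measure n. s $ of_nat i / A i * (\<Theta> i x * I s x)))"
    unfolding II_unit_circle_eq I_def[symmetric] I_shift c_def[symmetric]
    by (intro sum.cong refl) simp
  also have "\<dots> = c * (LINT x|torus_measure n. (\<Sum>i\<in>?T. s $ of_nat i / A i * (\<Theta> i x * I s x)))"
    unfolding sum_distrib_left[symmetric]
    by (subst Bochner_Integration.integral_sum) (intro integrable_mult_right int, rule refl)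
  also have "(\<lambda>x. \<Sum>i\<in>?T. s $ of_nat i / A i * (\<Theta> i x * I s x)) = (\<lambda>x. 0)"
  proof
    fix x
    have "(\<Sum>i\<in>?T. s $ of_nat i / A i * (\<Theta> i x * I s x)) = (\<Sum>i\<in>?T. s $ of_nat i / A i * \<Theta> i x) * I s x"
      unfolding sum_distrib_right by (simp only: mult.assoc)
    then show "(\<Sum>i\<in>?T. s $ of_nat i / A i * (\<Theta> i x * I s x)) = 0" by (simp only: id0 mult_zero_left)
  qed
  finally show ?thesis by (simp add: A_def)
qed

section \<open>Meromorphic continuation\<close>

text \<open>Outside the polydisc, two continuations differ by a meromorphic function that vanishes
  on the polydisc. Both are continuous at \<open>ts\<close>, hence equal there.\<close>

lemma II_value_unique:
  assumes "II_value n t p q ts v" "II_value n t p q ts w"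
  shows "v = w"
proof (cases "ts \<in> punctured_polydisc8")
  case True
  then show ?thesis using assms by (simp add: II_value_def)
next
  case False
  obtain F where F: "mv_meromorphic_on F cstar8" "\<forall>s\<in>punctured_polydisc8. F s = II_unit_circle n t p q s"
    "\<exists>U. open U \<and> ts \<in> U \<and> mv_holomorphic_on F U" "v = F ts" and ts: "ts \<in> cstar8"
    using assms(1) False unfolding II_value_def by auto
  obtain G where G: "mv_meromorphic_on G cstar8" "\<forall>s\<in>punctured_polydisc8. G s = II_unit_circle n t p q s"
    "\<exists>U. open U \<and> ts \<in> U \<and> mv_holomorphic_on G U" "w = G ts"
    using assms(2) False unfolding II_value_def by auto
  have "F ts + (- 1) * G ts = 0"
  proof (rule mv_meromorphic_eq_0[where F = "\<lambda>s. F s + (- 1) * G s"])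
    show "mv_meromorphic_on (\<lambda>s. F s + (- 1) * G s) cstar8"
      by (intro mv_meromorphic_on_add mv_meromorphic_on_mult_holomorphic mv_holomorphic_on_const F G open_cstar8)
    show "isCont (\<lambda>s. F s + (- 1) * G s) ts"
      using F(3) G(3) mv_holomorphic_on_imp_isCont by (intro continuous_intros) blast+
  qed (use F(2) G(2) ts open_cstar8 connected_cstar8 open_punctured_polydisc8
      punctured_polydisc8_nonempty punctured_polydisc8_subset in auto)
  then show ?thesis using F G by simp
qed

lemma II_eqI: "II_value n t p q ts v \<Longrightarrow> II n t p q ts = v"
  unfolding II_def using II_value_unique by blast

lemma II_eq_unit_circle: "ts \<in> punctured_polydisc8 \<Longrightarrow> II n t p q ts = II_unit_circle n t p q ts"
  by (rule II_eqI) (simp add: II_value_def)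

lemma II_continuation:
  assumes "II_defined n t p q ts" "ts \<notin> punctured_polydisc8"
  obtains F where "mv_meromorphic_on F cstar8" "\<And>s. s \<in> punctured_polydisc8 \<Longrightarrow> F s = II_unit_circle n t p q s"
    "isCont F ts" "F ts = II n t p q ts"
proof -
  obtain v where v: "II_value n t p q ts v" using assms(1) unfolding II_defined_def by blast
  then obtain F where "mv_meromorphic_on F cstar8" "\<forall>s\<in>punctured_polydisc8. F s = II_unit_circle n t p q s"
    "\<exists>U. open U \<and> ts \<in> U \<and> mv_holomorphic_on F U" "v = F ts"
    using assms(2) unfolding II_value_def by auto
  moreover from this have "isCont F ts" using mv_holomorphic_on_imp_isCont by blast
  ultimately show thesis using II_eqI[OF v] by (intro that[of F]) auto
qed

lemma mv_holomorphic_theta_pair: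
  assumes "norm p < 1"
  shows "mv_holomorphic_on (\<lambda>s. theta p (s $ a * s $ b) * theta p (s $ a / s $ b)) cstar8"
proof -
  have inv: "mv_holomorphic_on (\<lambda>s. inverse (s $ b)) cstar8"
    by (rule mv_holomorphic_on_compose[OF mv_holomorphic_on_component, where S = "- {0}"])
      (auto intro!: holomorphic_intros simp: cstar8_def)
  show ?thesis unfolding divide_inverse
    by (intro mv_holomorphic_on_mult mv_holomorphic_on_component inv
        mv_holomorphic_on_compose[OF _ theta_holomorphic[OF assms]])
      (auto simp: cstar8_def)
qed

theorem theorem3p1:
  fixes n :: nat and ts :: "complex^8" and t p q :: complex
  assumes "1 \<le> n" and "n \<le> 6"
    and "\<And>r. ts $ r \<noteq> 0"
    and "norm p < 1" and "norm q < 1" and "norm t < 1"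
    and "q \<noteq> 0" and "t \<noteq> 0"
    and "\<And>i. i \<le> n + 1 \<Longrightarrow> II_defined n t p q (q_shift q i ts)"
    and "\<And>i. i \<le> n + 1 \<Longrightarrow>
           (\<Prod>j\<in>{0..n + 1} - {i}.
              theta p (ts $ of_nat i * ts $ of_nat j) * theta p (ts $ of_nat i / ts $ of_nat j)) \<noteq> 0"
  shows "(\<Sum>i\<in>{0..n + 1}.
            ts $ of_nat i * II n t p q (q_shift q i ts) /
            (\<Prod>j\<in>{0..n + 1} - {i}.
               theta p (ts $ of_nat i * ts $ of_nat j) * theta p (ts $ of_nat i / ts $ of_nat j))) = 0"
proof (cases "ts \<in> punctured_polydisc8")
  \<comment> \<open>All shifted points lie in the polydisc as well, so every term is an integral
    over the torus and no continuation enters.\<close>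
  case True
  have "II n t p q (q_shift q i ts) = II_unit_circle n t p q (q_shift q i ts)" for i
    by (intro II_eq_unit_circle q_shift_punctured_polydisc8 True assms)
  then show ?thesis
    using II_unit_circle_q_shift_sum[OF assms(4-8) True] assms(10) by simp
next
  case False
  let ?T = "{0..n + 1}"
  have ts: "ts \<in> cstar8" using assms(3) by (simp add: cstar8_def)
  obtain r where r: "norm (ts $ r) \<ge> 1"
    using False assms(3) by (auto simp: punctured_polydisc8_def not_less)
  \<comment> \<open>Shifting a coordinate other than \<open>r\<close> leaves one of modulus at least
    1, so this shifted point is outside the polydisc and its definedness supplies a continuation.
    One of 0 and 1 differs from \<open>r\<close>, and both are at most \<open>n + 1\<close>.\<close>
  define l :: nat where "l = (if r = 0 then 1 else 0)"
  have "of_nat l \<noteq> r" by (simp add: l_def)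
  then have "q_shift q l ts $ r = ts $ r" by (simp add: q_shift_def)
  then have "q_shift q l ts \<notin> punctured_polydisc8"
    using r by (auto simp: punctured_polydisc8_def not_less intro!: exI[of _ r])
  moreover have "l \<le> n + 1" using assms(1) by (simp add: l_def)
  ultimately obtain F0 where F0: "mv_meromorphic_on F0 cstar8"
      "\<And>s. s \<in> punctured_polydisc8 \<Longrightarrow> F0 s = II_unit_circle n t p q s"
    using II_continuation assms(9) by metis
  \<comment> \<open>Every shifted point gets a representative that is continuous there: outside the
    polydisc by its own definedness, inside it \<open>F0\<close>, which agrees with the integral on
    a neighbourhood.\<close>
  have "\<exists>F. mv_meromorphic_on F cstar8 \<and> (\<forall>s\<in>punctured_polydisc8. F s = II_unit_circle n t p q s) \<and>
      isCont F (q_shift q i ts) \<and> F (q_shift q i ts) = II n t p q (q_shift q i ts)" if i: "i \<in> ?T" for i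
  proof (cases "q_shift q i ts \<in> punctured_polydisc8")
    case True
    have "eventually (\<lambda>s. F0 s = II_unit_circle n t p q s) (nhds (q_shift q i ts))"
      using eventually_nhds_in_open[OF open_punctured_polydisc8 True] by eventually_elim (rule F0(2))
    then have "isCont F0 (q_shift q i ts)"
      using II_unit_circle_isCont[OF assms(4-6,8) True] isCont_cong by blast
    then show ?thesis using F0 True II_eq_unit_circle by metis
  next
    case False
    then show ?thesis using II_continuation[OF assms(9) False] i by (metis atLeastAtMost_iff)
  qed
  then obtain F where F: "\<And>i. i \<in> ?T \<Longrightarrow> mv_meromorphic_on (F i) cstar8"
    "\<And>i s. i \<in> ?T \<Longrightarrow> s \<in> punctured_polydisc8 \<Longrightarrow> F i s = II_unit_circle n t p q s"
    "\<And>i. i \<in> ?T \<Longrightarrow> isCont (F i) (q_shift q i ts)"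
    "\<And>i. i \<in> ?T \<Longrightarrow> F i (q_shift q i ts) = II n t p q (q_shift q i ts)"
    by metis
  define A where "A s i = (\<Prod>j\<in>?T - {i}. theta p (s $ of_nat i * s $ of_nat j) * theta p (s $ of_nat i / s $ of_nat j))"
    for s :: "complex^8" and i
  define D where "D s = (\<Prod>i\<in>?T. A s i)" for s
  \<comment> \<open>\<open>D s / A s i\<close> is written as a product over the other indices, so
    that the coefficient is holomorphic also where \<open>A s i\<close> vanishes.\<close>
  define W where "W i s = s $ of_nat i * (\<Prod>k\<in>?T - {i}. A s k)" for i and s :: "complex^8"
  define G where "G s = (\<Sum>i\<in>?T. W i s * F i (q_shift q i s))" for s
  have A: "mv_holomorphic_on (\<lambda>s. A s i) cstar8" for i
    unfolding A_def by (intro mv_holomorphic_on_prod mv_holomorphic_theta_pair assms)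
  have D: "mv_holomorphic_on D cstar8"
    unfolding D_def[abs_def] by (intro mv_holomorphic_on_prod A)
  have W: "mv_holomorphic_on (W i) cstar8" for i
    unfolding W_def[abs_def] by (intro mv_holomorphic_on_mult mv_holomorphic_on_component mv_holomorphic_on_prod A)
  have G_eq: "G s = D s * (\<Sum>i\<in>?T. s $ of_nat i * F i (q_shift q i s) / A s i)" if "D s \<noteq> 0" for s
    unfolding G_def sum_distrib_left
  proof (rule sum.cong[OF refl])
    fix i assume i: "i \<in> ?T"
    have "A s i \<noteq> 0" using that i prod_zero[of ?T "A s"] unfolding D_def by blast
    moreover have "D s = A s i * (\<Prod>k\<in>?T - {i}. A s k)"
      unfolding D_def using i by (intro prod.remove) auto
    ultimately show "W i s * F i (q_shift q i s) = D s * (s $ of_nat i * F i (q_shift q i s) / A s i)"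
      by (simp add: W_def)
  qed
  have "A ts i \<noteq> 0" if "i \<in> ?T" for i
    unfolding A_def by (rule assms(10)) (use that in simp)
  then have Dts: "D ts \<noteq> 0" unfolding D_def prod_zero_iff[OF finite_atLeastAtMost] by blast
  have "G ts = 0"
  proof (rule mv_meromorphic_eq_0[OF _ open_cstar8 connected_cstar8])
    let ?V = "{s \<in> punctured_polydisc8. D s \<noteq> 0}"
    show "mv_meromorphic_on G cstar8"
      unfolding G_def[abs_def]
      by (intro mv_meromorphic_on_sum mv_meromorphic_on_mult_holomorphic W open_cstar8
          mv_meromorphic_on_q_shift F assms)
    show "open ?V"
      by (rule mv_holomorphic_nonzero_open[OF D open_punctured_polydisc8 punctured_polydisc8_subset])
    \<comment> \<open>If \<open>D\<close> vanished on the polydisc, it would vanish on all of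
      \<open>cstar8\<close>, contrary to \<open>Dts\<close>.\<close>
    show "?V \<noteq> {}"
      using mv_identity_theorem[OF D open_cstar8 connected_cstar8 open_punctured_polydisc8
          punctured_polydisc8_nonempty punctured_polydisc8_subset _ ts] Dts by blast
    show "?V \<subseteq> cstar8" using punctured_polydisc8_subset by blast
    show "G s = 0" if s: "s \<in> ?V" for s
    proof -
      have "F i (q_shift q i s) = II_unit_circle n t p q (q_shift q i s)" if "i \<in> ?T" for i
        using s that by (intro F(2) q_shift_punctured_polydisc8 assms) auto
      moreover have "A s i \<noteq> 0" if "i \<in> ?T" for i
        using s that prod_zero[of ?T "A s"] unfolding D_def by blast
      then have "(\<Sum>i\<in>?T. s $ of_nat i * II_unit_circle n t p q (q_shift q i s) / A s i) = 0"
        unfolding A_def using s by (intro II_unit_circle_q_shift_sum assms) auto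
      ultimately show ?thesis using G_eq[of s] s by simp
    qed
    show "isCont G ts"
      unfolding G_def[abs_def]
    proof (intro continuous_intros)
      fix i assume i: "i \<in> ?T"
      show "isCont (W i) ts" by (rule mv_holomorphic_on_imp_isCont[OF W ts])
      have "isCont (q_shift q i) ts" by (rule linear_continuous_at[OF q_shift_linear(1)])
      then show "isCont (\<lambda>s. F i (q_shift q i s)) ts"
        using F(3)[OF i] by (rule isCont_o2)
    qed
  qed (rule ts)
  then have "(\<Sum>i\<in>?T. ts $ of_nat i * F i (q_shift q i ts) / A ts i) = 0"
    using G_eq[OF Dts] Dts by simp
  then show ?thesis using F(4) by (simp add: A_def)
qed

end
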